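(* Let $\mathcal{X}$ and $\mathcal{Y}$ be finite sets, let $X$ be a random variable on $\mathcal{X}$ with distribution $p_X$, let $d:\mathcal{X}\times\mathcal{Y}\to[0,\infty)$ be a distortion function, and let $D$ be a distortion level. Let $\mathcal{C}_{X,D}$ be the set of all channels that directly communicate the i.i.d. $X$ source to within distortion level $D$, let $C_{sc}(\mathcal{C}_{X,D})$ be its universal capacity over stochastic-coupled encoder-decoders (random codes with common randomness), and let $R_X(D)$ be the operational rate-distortion function of the i.i.d. $X$ source. Then $$C_{sc}(\mathcal{C}_{X,D}) = R_X(D).$$
   Context: **Channels.** A channel with input alphabet $\mathcal{X}$ and output alphabet $\mathcal{Y}$ is a sequence $c=\langle c^n\rangle_{n=1}^\infty$, where $c^n$ is an arbitrary transition probability matrix from $\mathcal{X}^n$ to $\mathcal{Y}^n$: $c^n_{xy}$ is the probability that the output is $y\in\mathcal{Y}^n$ when the input is $x\in\mathcal{X}^n$. No causality, memorylessness, or consistency between different $n$ is assumed. **The set $\mathcal{C}_{X,D}$.** Let $X^n$ be i.i.d. with law $p_X$ in each coordinate, and let $Y^n$ be the output of $c^n$ with input $X^n$. The channel $c$ belongs to $\mathcal{C}_{X,D}$ iff $$\Pr\Big(\frac1n\sum_{i=1}^n d(X^n(i),Y^n(i))>D\Big)\to 0\quad\text{as } n\to\infty.$$ **Codes.** For rate $R\ge 0$ the message set is $\mathcal{M}^n=\{1,2,\dots,2^{nR}\}$ (read $\lfloor 2^{nR}\rfloor$ if $2^{nR}$ is not an integer). A deterministic encoder-decoder pair of block length $n$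 is a pair of maps $\mathcal{M}^n\to\mathcal{X}^n$ and $\mathcal{Y}^n\to\mathcal{M}^n$. A stochastic-coupled (sc) encoder-decoder $(e^n,d^n)$ is a random such pair, i.e. a probability distribution on the set of deterministic pairs. Encoder and decoder share the realization through common randomness, and the amount of common randomness is unrestricted. The randomness of the code is independent of the message and of the channel. (The decoder $d^n$ is unrelated to the distortion function $d$.) **Universal capacity.** Let $\mathcal{A}$ be a set of channels. Rate $R$ is universally achievable over $\mathcal{A}$ if there is a sequence $\langle e^n,d^n\rangle_{n=1}^\infty$ of sc-encoder-decoders of rate $R$, not depending on which channel of $\mathcal{A}$ is used, such that for every $c\in\mathcal{A}$ the following holds: if $M^n$ is uniform on $\mathcal{M}^n$ and $\widehat{M}^n$ is the output of the composition of encoder $e^n$, channel $c^n$, and decoder $d^n$ with input $M^n$, then $\Pr(\widehat{M}^n\ne M^n)\to 0$ as $n\to\infty$. (No uniformity in $c$ of the convergence is required.) $C_{sc}(\mathcal{A})$ is the supremum of universally achievable rates. **Operational rate-distortion function.** A rate $R$ is achievable for source coding the i.i.d. $X$ source to within distortion $D$ if for every $\delta>0$ and $\epsilon>0$, for all sufficiently large $n$ there is a deterministic map $s^n:\mathcal{X}^n\to\mathcal{Y}^n$ whose image has at most $2^{n(R+\delta)}$ elements and such that $\Pr\big(\frac1n\sum_{i=1}^n d(X^n(i),s^n(X^n)(i))>D\big)\le\epsilon$. $R_X(D)$ is the infimum of achievable rates $R\ge0$ (with $\inf\emptyset=+\infty$). *)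

theory Defs
  imports "HOL-Probability.Probability"
begin

text \<open>The alphabets are finite types. A block of length \<open>n\<close> over an alphabet is a list of length \<open>n\<close>.\<close>

definition blocks :: "nat \<Rightarrow> 'a list set" where
  "blocks n = {xs. length xs = n}"

text \<open>\<open>c n xs\<close> is row \<open>xs\<close> of the transition matrix of block length \<open>n\<close>. Only the values at
  \<open>n \<ge> 1\<close> and \<open>xs \<in> blocks n\<close> are meaningful; \<open>is_channel\<close> leaves the others unconstrained.\<close>

type_synonym ('x, 'y) channel = "nat \<Rightarrow> 'x list \<Rightarrow> 'y list pmf"

definition is_channel :: "('x, 'y) channel \<Rightarrow> bool" where
  "is_channel c \<longleftrightarrow> (\<forall>n\<ge>1. \<forall>xs\<in>blocks n. set_pmf (c n xs) \<subseteq> blocks n)"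

definition avg_distortion :: "('x \<Rightarrow> 'y \<Rightarrow> real) \<Rightarrow> nat \<Rightarrow> 'x list \<Rightarrow> 'y list \<Rightarrow> real" where
  "avg_distortion d n xs ys = (1 / real n) * (\<Sum>i<n. d (xs ! i) (ys ! i))"

definition input_output :: "'x pmf \<Rightarrow> ('x, 'y) channel \<Rightarrow> nat \<Rightarrow> ('x list \<times> 'y list) pmf" where
  "input_output p c n =
     bind_pmf (replicate_pmf n p) (\<lambda>xs. map_pmf (\<lambda>ys. (xs, ys)) (c n xs))"

definition channels_within ::
  "'x pmf \<Rightarrow> ('x \<Rightarrow> 'y \<Rightarrow> real) \<Rightarrow> real \<Rightarrow> ('x, 'y) channel set" where
  "channels_within p d D = {c. is_channel c \<and>
     (\<lambda>n. measure_pmf.prob (input_output p c n) {(xs, ys). avg_distortion d n xs ys > D})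
       \<longlonglongrightarrow> 0}"

definition messages :: "real \<Rightarrow> nat \<Rightarrow> nat set" where
  "messages R n = {1 .. nat \<lfloor>2 powr (real n * R)\<rfloor>}"

text \<open>Encoders and decoders are extensional functions, so that distinct pairs of functions in
  \<open>det_codes R n\<close> are distinct as deterministic codes and the set is finite.\<close>

definition det_codes :: "real \<Rightarrow> nat \<Rightarrow> ((nat \<Rightarrow> 'x list) \<times> ('y list \<Rightarrow> nat)) set" where
  "det_codes R n = (messages R n \<rightarrow>\<^sub>E blocks n) \<times> (blocks n \<rightarrow>\<^sub>E messages R n)"

type_synonym ('x, 'y) sc_code = "nat \<Rightarrow> ((nat \<Rightarrow> 'x list) \<times> ('y list \<Rightarrow> nat)) pmf"

definition is_sc_code :: "real \<Rightarrow> ('x, 'y) sc_code \<Rightarrow> bool" where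
  "is_sc_code R k \<longleftrightarrow> (\<forall>n\<ge>1. set_pmf (k n) \<subseteq> det_codes R n)"

text \<open>The joint law of the message and the decoded message: the message is uniform, the code is
  drawn independently of it, and the channel acts on the encoded message only.\<close>

definition message_decoded ::
  "real \<Rightarrow> ('x, 'y) sc_code \<Rightarrow> ('x, 'y) channel \<Rightarrow> nat \<Rightarrow> (nat \<times> nat) pmf" where
  "message_decoded R k c n =
     bind_pmf (pmf_of_set (messages R n)) (\<lambda>m.
     bind_pmf (k n) (\<lambda>(enc, dec).
     map_pmf (\<lambda>ys. (m, dec ys)) (c n (enc m))))"

definition universally_achievable :: "('x, 'y) channel set \<Rightarrow> real \<Rightarrow> bool" where
  "universally_achievable A R \<longleftrightarrow> R \<ge> 0 \<and>
     (\<exists>k. is_sc_code R k \<and>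
       (\<forall>c\<in>A. (\<lambda>n. measure_pmf.prob (message_decoded R k c n) {(m, m'). m' \<noteq> m})
                 \<longlonglongrightarrow> 0))"

definition universal_capacity :: "('x, 'y) channel set \<Rightarrow> ereal" where
  "universal_capacity A = Sup (ereal ` {R. universally_achievable A R})"

definition source_achievable ::
  "'x pmf \<Rightarrow> ('x \<Rightarrow> 'y \<Rightarrow> real) \<Rightarrow> real \<Rightarrow> real \<Rightarrow> bool" where
  "source_achievable p d D R \<longleftrightarrow> R \<ge> 0 \<and>
     (\<forall>\<delta>>0. \<forall>\<epsilon>>0. \<forall>\<^sub>F n in sequentially. \<exists>s :: 'x list \<Rightarrow> 'y list.
        s \<in> blocks n \<rightarrow> blocks n \<and>
        real (card (s ` blocks n)) \<le> 2 powr (real n * (R + \<delta>)) \<and>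
        measure_pmf.prob (replicate_pmf n p) {xs. avg_distortion d n xs (s xs) > D} \<le> \<epsilon>)"

definition rate_distortion :: "'x pmf \<Rightarrow> ('x \<Rightarrow> 'y \<Rightarrow> real) \<Rightarrow> real \<Rightarrow> ereal" where
  "rate_distortion p d D = Inf (ereal ` {R. source_achievable p d D R})"

end

theory Submission
  imports Defs
begin

text \<open>A good source code, viewed as a deterministic channel, lies in \<open>channels_within p d D\<close> and carries
  no more messages than it has code words; this bounds the capacity from above.

  Conversely, suppose that \<open>r\<close> is not achievable for source coding and that \<open>channels_within p d D\<close>
  is not empty. Random coding shows that every test channel of distortion below \<open>D\<close> has information
  at least \<open>r\<close>, and convex duality turns this into weights \<open>l > 0\<close> and a kernel
  \<open>k x y = exp (- s * (d x y - D))\<close> such that \<open>l x * k x y\<close> has mean at most 1 under \<open>p\<close> for each \<open>y\<close>,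
  while \<open>ln (l x)\<close> has mean at least \<open>r * ln 2\<close>. By Markov's inequality an independent code word is
  \<open>l\<close>-typical and within distortion \<open>D\<close> of a fixed output with probability about \<open>2 powr (- n * r)\<close>, so
  an i.i.d. codebook of rate below \<open>r\<close> is decoded correctly whatever the channel does. The only case
  without a Lagrange multiplier is that the smallest distortion is equal to \<open>D\<close> for almost every source
  letter; there \<open>k\<close> is the indicator of \<open>d x y \<le> D\<close>.\<close>

section \<open>Products of finitely supported distributions\<close>

lemma prob_bind_pmf:
  "measure_pmf.prob (bind_pmf p f) A = measure_pmf.expectation p (\<lambda>x. measure_pmf.prob (f x) A)"
proof -
  have "ennreal (measure_pmf.prob (bind_pmf p f) A) = (\<integral>\<^sup>+x. emeasure (measure_pmf (f x)) A \<partial>measure_pmf p)"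
    by (simp flip: measure_pmf.emeasure_eq_measure)
  also have "\<dots> = (\<integral>\<^sup>+x. ennreal (measure_pmf.prob (f x) A) \<partial>measure_pmf p)"
    by (simp add: measure_pmf.emeasure_eq_measure)
  also have "\<dots> = ennreal (measure_pmf.expectation p (\<lambda>x. measure_pmf.prob (f x) A))"
    by (intro nn_integral_eq_integral measure_pmf.integrable_const_bound[where B=1]) auto
  finally show ?thesis
    by (simp add: integral_nonneg_AE)
qed

text \<open>Compares two experiments that share their first draw. Applied twice, to the source word
  and then to the channel output, it reduces the decoding error to a comparison with both of them
  fixed.\<close>

lemma prob_bind_pmf_le_add:
  assumes "\<And>x. x \<in> set_pmf p \<Longrightarrow> measure_pmf.prob (f x) A \<le> measure_pmf.prob (g x) B + \<beta>"
  shows "measure_pmf.prob (bind_pmf p f) A \<le> measure_pmf.prob (bind_pmf p g) B + \<beta>"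
proof -
  have i: "integrable (measure_pmf p) (\<lambda>x. measure_pmf.prob (h x) C)" for h :: "'a \<Rightarrow> 'd pmf" and C
    by (rule measure_pmf.integrable_const_bound[where B=1]) auto
  have "measure_pmf.expectation p (\<lambda>x. measure_pmf.prob (f x) A)
      \<le> measure_pmf.expectation p (\<lambda>x. measure_pmf.prob (g x) B + \<beta>)"
    using assms by (intro integral_mono_AE Bochner_Integration.integrable_add i) (auto intro: AE_pmfI)
  also have "\<dots> = measure_pmf.expectation p (\<lambda>x. measure_pmf.prob (g x) B) + \<beta>"
    by (subst Bochner_Integration.integral_add) (auto intro: i)
  finally show ?thesis by (simp add: prob_bind_pmf)
qed

lemma prob_bind_pmf_le:
  assumes "\<And>x. x \<in> set_pmf p \<Longrightarrow> measure_pmf.prob (f x) A \<le> \<beta>"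
  shows "measure_pmf.prob (bind_pmf p f) A \<le> \<beta>"
  using prob_bind_pmf_le_add[of p f A "\<lambda>_. p" "{}" \<beta>] assms by simp

lemma prob_le_expectation:
  fixes h :: "'a \<Rightarrow> real"
  assumes "finite (set_pmf p)"
    and "\<And>x. x \<in> set_pmf p \<Longrightarrow> 0 \<le> h x" and "\<And>x. x \<in> set_pmf p \<Longrightarrow> x \<in> A \<Longrightarrow> 1 \<le> h x"
  shows "measure_pmf.prob p A \<le> measure_pmf.expectation p h"
proof -
  have "measure_pmf.prob p A = measure_pmf.expectation p (indicator A)" by simp
  also have "\<dots> \<le> measure_pmf.expectation p h"
    using assms by (intro integral_mono_AE integrable_measure_pmf_finite)
      (auto intro!: AE_pmfI simp: indicator_def)
  finally show ?thesis .
qed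

lemma expectation_bind_pmf_finite:
  fixes h :: "'b \<Rightarrow> real"
  assumes "finite (set_pmf p)" "\<And>x. x \<in> set_pmf p \<Longrightarrow> finite (set_pmf (f x))"
  shows "measure_pmf.expectation (bind_pmf p f) h = measure_pmf.expectation p (\<lambda>x. measure_pmf.expectation (f x) h)"
  using assms by (subst pmf_expectation_bind[of "set_pmf p"])
    (auto simp: integral_measure_pmf_real[of "set_pmf p"] mult.commute)

text \<open>The probabilistic method: it later extracts a single codebook from a random one.\<close>

lemma exists_le_expectation:
  fixes h :: "'a \<Rightarrow> real"
  assumes "finite (set_pmf p)"
  obtains x where "x \<in> set_pmf p" "h x \<le> measure_pmf.expectation p h"
proof (rule ccontr)
  assume "\<not> thesis"
  then have less: "\<And>x. x \<in> set_pmf p \<Longrightarrow> measure_pmf.expectation p h < h x"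
    using that by force
  have "measure_pmf.expectation p h = (\<Sum>x\<in>set_pmf p. h x * pmf p x)"
    using assms by (auto simp: integral_measure_pmf_real[of "set_pmf p"])
  also have "\<dots> > (\<Sum>x\<in>set_pmf p. measure_pmf.expectation p h * pmf p x)"
    using less assms set_pmf_not_empty[of p] by (intro sum_strict_mono mult_strict_right_mono) (auto intro: pmf_positive)
  finally show False
    using assms by (simp add: sum_pmf_eq_1 flip: sum_distrib_left)
qed

lemma finite_set_replicate_pmf:
  "finite (set_pmf p) \<Longrightarrow> finite (set_pmf (replicate_pmf n p))"
  using finite_lists_length_eq[of "set_pmf p" n]
  by (auto simp: set_replicate_pmf lists_eq_set)

lemma expectation_replicate_pmf_Suc:
  fixes h :: "'a list \<Rightarrow> real"
  assumes "finite (set_pmf p)"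
  shows "measure_pmf.expectation (replicate_pmf (Suc n) p) h =
    measure_pmf.expectation p (\<lambda>x. measure_pmf.expectation (replicate_pmf n p) (\<lambda>xs. h (x # xs)))"
  using assms finite_set_replicate_pmf[OF assms, of n]
  by (simp add: expectation_bind_pmf_finite)

text \<open>The factors may vary with the position because the kernel will be evaluated at the
  letters \<open>ys ! i\<close> of a fixed output.\<close>

lemma expectation_replicate_pmf_prod:
  fixes g :: "nat \<Rightarrow> 'a \<Rightarrow> real"
  assumes "finite (set_pmf p)"
  shows "measure_pmf.expectation (replicate_pmf n p) (\<lambda>xs. \<Prod>i<n. g i (xs ! i)) =
    (\<Prod>i<n. measure_pmf.expectation p (g i))"
proof (induction n arbitrary: g)
  case (Suc n)
  show ?case
    using Suc.IH[of "\<lambda>i. g (Suc i)"]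
    by (simp add: expectation_replicate_pmf_Suc[OF assms] prod.lessThan_Suc_shift
        del: replicate_pmf.simps prod.lessThan_Suc)
qed simp

lemma replicate_pmf_nth_in:
  assumes "xs \<in> set_pmf (replicate_pmf n p)" "i < n"
  shows "xs ! i \<in> set_pmf p"
  using assms by (force simp: set_replicate_pmf lists_eq_set)

lemma length_replicate_pmf: "xs \<in> set_pmf (replicate_pmf n p) \<Longrightarrow> length xs = n"
  by (simp add: set_replicate_pmf)

text \<open>Chernoff's bound. The moment generating function \<phi> of \<open>f - c\<close> equals 1
  at 0 and has negative derivative there, so some \<open>t > 0\<close> has
  \<open>\<phi> t < 1\<close>, and the tail is at most \<open>\<phi> t ^ n\<close>.\<close>

lemma replicate_pmf_upper_tail:
  fixes p :: "'a pmf" and f :: "'a \<Rightarrow> real"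
  assumes fin: "finite (set_pmf p)" and less: "measure_pmf.expectation p f < c"
  shows "(\<lambda>n. measure_pmf.prob (replicate_pmf n p) {xs. (\<Sum>i<n. f (xs ! i)) > real n * c}) \<longlonglongrightarrow> 0"
proof -
  define \<phi> where "\<phi> t = (\<Sum>x\<in>set_pmf p. exp (t * (f x - c)) * pmf p x)" for t
  have "(\<phi> has_real_derivative (\<Sum>x\<in>set_pmf p. (f x - c) * pmf p x)) (at 0)"
    unfolding \<phi>_def by (auto intro!: derivative_eq_intros sum.cong)
  moreover have "(\<Sum>x\<in>set_pmf p. (f x - c) * pmf p x) = measure_pmf.expectation p f - c"
    using fin by (simp add: integral_measure_pmf_real[of "set_pmf p"] algebra_simps sum_subtractf
        sum_pmf_eq_1 flip: sum_distrib_left)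
  ultimately obtain e where e: "e > 0" "\<forall>h>0. h < e \<longrightarrow> \<phi> 0 > \<phi> (0 + h)"
    using DERIV_neg_dec_right[of \<phi> _ 0] less by force
  define t where "t = e / 2"
  have t: "t > 0" and "\<phi> t < \<phi> 0" using e by (auto simp: t_def)
  then have "\<phi> t < 1" using fin by (simp add: \<phi>_def sum_pmf_eq_1)
  have "\<phi> t \<ge> 0" unfolding \<phi>_def by (auto intro: sum_nonneg)
  have bound: "measure_pmf.prob (replicate_pmf n p) {xs. (\<Sum>i<n. f (xs ! i)) > real n * c} \<le> \<phi> t ^ n" for n
  proof -
    have "measure_pmf.prob (replicate_pmf n p) {xs. (\<Sum>i<n. f (xs ! i)) > real n * c}
        \<le> measure_pmf.expectation (replicate_pmf n p) (\<lambda>xs. \<Prod>i<n. exp (t * (f (xs ! i) - c)))"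
    proof (rule prob_le_expectation)
      fix xs assume "xs \<in> {xs. (\<Sum>i<n. f (xs ! i)) > real n * c}"
      then have "0 \<le> t * (\<Sum>i<n. f (xs ! i) - c)"
        using t by (simp add: sum_subtractf)
      then show "1 \<le> (\<Prod>i<n. exp (t * (f (xs ! i) - c)))"
        by (simp add: sum_distrib_left flip: exp_sum)
    qed (use fin finite_set_replicate_pmf in \<open>auto intro: prod_nonneg\<close>)
    also have "\<dots> = \<phi> t ^ n"
      using fin by (simp add: expectation_replicate_pmf_prod[where g = "\<lambda>_ x. exp (t * (f x - c))"]
          integral_measure_pmf_real[of "set_pmf p"] \<phi>_def)
    finally show ?thesis .
  qed
  show ?thesis
    by (rule tendsto_sandwich[OF _ _ tendsto_const LIMSEQ_realpow_zero[of "\<phi> t"]])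
      (use bound \<open>\<phi> t < 1\<close> \<open>\<phi> t \<ge> 0\<close> in auto)
qed

section \<open>Anti-concentration of centred sums\<close>

lemma exp_le_quadratic:
  fixes x :: real
  assumes "\<bar>x\<bar> \<le> 1"
  shows "exp x \<le> 1 + x + x\<^sup>2"
proof (cases "x \<ge> 0")
  case True
  then show ?thesis using assms exp_bound[of x] by simp
next
  case False
  define y where "y = - x"
  have y: "0 < y" "y \<le> 1" using False assms by (auto simp: y_def)
  have "exp x = 1 / exp y" by (simp add: y_def exp_minus inverse_eq_divide)
  also have "\<dots> \<le> 1 / (1 + y)" using y exp_ge_add_one_self[of y] by (intro divide_left_mono) auto
  also have "\<dots> \<le> 1 - y + y\<^sup>2"
  proof -
    have "(1 - y + y\<^sup>2) * (1 + y) = 1 + y ^ 3" by algebra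
    then have "1 \<le> (1 - y + y\<^sup>2) * (1 + y)" using y by simp
    then show ?thesis using y by (simp add: divide_le_eq)
  qed
  finally show ?thesis by (simp add: y_def)
qed

text \<open>Only the positive part keeps a quadratic term, since for negative \<open>x\<close> the
  exponential lies below \<open>1 + x + x\<^sup>2 / 2\<close>.\<close>

lemma exp_ge_quadratic_pos_part:
  fixes x :: real
  shows "exp x \<ge> 1 + x + (max 0 x)\<^sup>2 / 2"
proof (cases "x \<ge> 0")
  case True
  then show ?thesis using exp_lower_Taylor_quadratic[of x] by simp
next
  case False
  then show ?thesis using exp_ge_add_one_self[of x] by simp
qed

text \<open>At scale \<open>t = 1 / sqrt n\<close> the moment generating function of the sum is at least \<open>1 + v\<close> with \<open>v\<close>
  independent of \<open>n\<close>, and by the bound on its value at \<open>2 * t\<close> this excess cannot come from an event of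
  vanishing probability.\<close>

lemma replicate_pmf_mean_zero_eq_0:
  fixes p :: "'a pmf" and f :: "'a \<Rightarrow> real"
  assumes fin: "finite (set_pmf p)" and mean: "measure_pmf.expectation p f = 0"
    and lim: "(\<lambda>n. measure_pmf.prob (replicate_pmf n p) {xs. (\<Sum>i<n. f (xs ! i)) > 0}) \<longlonglongrightarrow> 0"
    and x: "x \<in> set_pmf p"
  shows "f x = 0"
proof -
  define v where "v = measure_pmf.expectation p (\<lambda>x. (max 0 (f x))\<^sup>2) / 2"
  \<comment> \<open>The summand 1 gives \<open>B \<ge> 1\<close>, so that
    \<open>n \<ge> 4 * B\<^sup>2\<close> also excludes \<open>n = 0\<close>.\<close>
  define B where "B = 1 + (\<Sum>x\<in>set_pmf p. \<bar>f x\<bar>)"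
  define P where "P n = measure_pmf.prob (replicate_pmf n p) {xs. (\<Sum>i<n. f (xs ! i)) > 0}" for n
  define \<phi> where "\<phi> t = measure_pmf.expectation p (\<lambda>x. exp (t * f x))" for t
  have B: "\<bar>f x\<bar> \<le> B" if "x \<in> set_pmf p" for x
    using member_le_sum[of x "set_pmf p" "\<lambda>x. \<bar>f x\<bar>"] that fin by (simp add: B_def)
  have "B \<ge> 1" unfolding B_def by (simp add: sum_nonneg)
  note int = integrable_measure_pmf_finite[OF fin]
  have "v \<ge> 0" unfolding v_def by simp
  have "v = 0"
  proof (rule ccontr)
    assume "v \<noteq> 0"
    then have v: "v > 0" using \<open>v \<ge> 0\<close> by simp
    \<comment> \<open>Chosen so that \<open>(\<eta> / 2) * exp (4 * B\<^sup>2)\<close> is half of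
      the excess \<open>v\<close>; the other half must then come from \<open>P n\<close>.\<close>
    define \<eta> where "\<eta> = v * exp (- 4 * B\<^sup>2)"
    have \<eta>: "\<eta> > 0" using v by (simp add: \<eta>_def)
    have lower: "\<phi> t \<ge> 1 + t\<^sup>2 * v" if "t \<ge> 0" for t
    proof -
      have "1 + t\<^sup>2 * v = measure_pmf.expectation p (\<lambda>x. 1 + t * f x + t\<^sup>2 / 2 * (max 0 (f x))\<^sup>2)"
        using mean by (simp add: int v_def)
      also have "\<dots> \<le> \<phi> t"
        unfolding \<phi>_def
      proof (intro integral_mono int)
        fix x
        show "1 + t * f x + t\<^sup>2 / 2 * (max 0 (f x))\<^sup>2 \<le> exp (t * f x)"
          using exp_ge_quadratic_pos_part[of "t * f x"] that
          by (auto simp: max_def power_mult_distrib mult_le_0_iff zero_le_mult_iff split: if_splits)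
      qed
      finally show ?thesis .
    qed
    have upper: "\<phi> t \<le> 1 + t\<^sup>2 * B\<^sup>2" if "0 \<le> t" "t * B \<le> 1" for t
    proof -
      have "\<phi> t \<le> measure_pmf.expectation p (\<lambda>x. 1 + t * f x + t\<^sup>2 * B\<^sup>2)"
        unfolding \<phi>_def
      proof (intro integral_mono_AE int AE_pmfI)
        fix x assume "x \<in> set_pmf p"
        then have *: "\<bar>t * f x\<bar> \<le> t * B" using B that by (simp add: abs_mult mult_left_mono)
        then have "(t * f x)\<^sup>2 \<le> (t * B)\<^sup>2" by (metis abs_ge_zero power2_abs power_mono)
        with exp_le_quadratic[of "t * f x"] * that
        show "exp (t * f x) \<le> 1 + t * f x + t\<^sup>2 * B\<^sup>2" by (simp add: power_mult_distrib)
      qed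
      also have "\<dots> = 1 + t\<^sup>2 * B\<^sup>2" using mean by (simp add: int)
      finally show ?thesis .
    qed
    \<comment> \<open>The threshold on \<open>n\<close> makes \<open>2 * t * B \<le> 1\<close> for
      \<open>t = 1 / sqrt n\<close>, which is what \<open>upper\<close> requires at
      \<open>2 * t\<close>.\<close>
    have "v * \<eta> \<le> P n" if n: "real n \<ge> 4 * B\<^sup>2" for n
    proof -
      define S where "S xs = (\<Sum>i<n. f (xs ! i))" for xs
      define t where "t = 1 / sqrt n"
      have "n > 0" using n \<open>B \<ge> 1\<close> by (cases n) auto
      then have t: "t > 0" "t\<^sup>2 = 1 / n" by (auto simp: t_def power_divide)
      have "2 * B \<le> sqrt n" using n \<open>B \<ge> 1\<close> by (intro real_le_rsqrt) (simp add: power_mult_distrib)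
      then have tB: "2 * t * B \<le> 1" using \<open>n > 0\<close> by (simp add: t_def)
      have mgf: "measure_pmf.expectation (replicate_pmf n p) (\<lambda>xs. exp (u * S xs)) = \<phi> u ^ n" for u
        using expectation_replicate_pmf_prod[OF fin, where g = "\<lambda>_ x. exp (u * f x)" and n = n]
        by (simp add: S_def \<phi>_def sum_distrib_left exp_sum)
      note intn = integrable_measure_pmf_finite[OF finite_set_replicate_pmf[OF fin, of n]]
      have "0 \<le> t\<^sup>2 * v" using v by simp
      then have "- 1 \<le> t\<^sup>2 * v" by linarith
      then have "1 + v \<le> (1 + t\<^sup>2 * v) ^ n"
        using Bernoulli_inequality[of "t\<^sup>2 * v" n] t v \<open>n > 0\<close> by simp
      also have "\<dots> \<le> \<phi> t ^ n" using lower[of t] t v by (intro power_mono) auto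
      also have "\<dots> \<le> measure_pmf.expectation (replicate_pmf n p)
          (\<lambda>xs. 1 + (\<eta> / 2) * exp (2 * t * S xs) + (1 / (2 * \<eta>)) * indicator {xs. S xs > 0} xs)"
        unfolding mgf[symmetric]
      proof (intro integral_mono intn)
        fix xs
        \<comment> \<open>On \<open>S xs > 0\<close> this is the inequality of arithmetic and
          geometric means with weight \<eta>; elsewhere the left side is at most 1.\<close>
        show "exp (t * S xs) \<le> 1 + (\<eta> / 2) * exp (2 * t * S xs) + (1 / (2 * \<eta>)) * indicator {xs. S xs > 0} xs"
        proof (cases "S xs > 0")
          case True
          have "0 \<le> (\<eta> * exp (t * S xs) - 1)\<^sup>2 / (2 * \<eta>)" using \<eta> by simp
          also have "\<dots> = (\<eta> / 2) * exp (2 * t * S xs) + 1 / (2 * \<eta>) - exp (t * S xs)"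
            using \<eta> by (simp add: power2_eq_square field_simps flip: exp_add)
          finally show ?thesis using True by simp
        next
          case False
          then have "exp (t * S xs) \<le> 1" using t by (simp add: mult_le_0_iff)
          moreover have "0 \<le> (\<eta> / 2) * exp (2 * t * S xs)" using \<eta> by simp
          ultimately show ?thesis using False by (auto intro: order_trans)
        qed
      qed
      also have "\<dots> = 1 + (\<eta> / 2) * \<phi> (2 * t) ^ n + P n / (2 * \<eta>)"
        using mgf[of "2 * t"] by (simp add: intn P_def S_def)
      also have "\<phi> (2 * t) ^ n \<le> exp (4 * B\<^sup>2)"
      proof -
        have "\<phi> (2 * t) \<le> 1 + 4 * B\<^sup>2 / n" using upper[of "2 * t"] tB t by (simp add: power_mult_distrib)
        also have "\<dots> \<le> exp (4 * B\<^sup>2 / n)" by (rule exp_ge_add_one_self)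
        finally have "\<phi> (2 * t) ^ n \<le> exp (4 * B\<^sup>2 / n) ^ n"
          by (intro power_mono) (auto simp: \<phi>_def)
        also have "\<dots> = exp (4 * B\<^sup>2)" using \<open>n > 0\<close> by (simp flip: exp_of_nat_mult)
        finally show ?thesis .
      qed
      finally have "1 + v \<le> 1 + (\<eta> / 2) * exp (4 * B\<^sup>2) + P n / (2 * \<eta>)"
        using \<eta> by (simp add: mult_left_mono)
      also have "(\<eta> / 2) * exp (4 * B\<^sup>2) = v / 2" by (simp add: \<eta>_def flip: exp_add)
      finally show ?thesis using \<eta> by (simp add: field_simps)
    qed
    then have "\<forall>\<^sub>F n in sequentially. v * \<eta> \<le> P n"
      by (intro eventually_sequentiallyI[of "nat \<lceil>4 * B\<^sup>2\<rceil>"]) (auto simp: nat_le_iff ceiling_le_iff)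
    from tendsto_lowerbound[OF lim[folded P_def] this] show False using v \<eta> by (simp add: mult_le_0_iff)
  qed
  \<comment> \<open>A vanishing second moment of the positive part makes \<open>f\<close>
    nonpositive on the support, and mean zero then makes it vanish there.\<close>
  then have nonpos: "f x \<le> 0" if "x \<in> set_pmf p" for x
  proof -
    have "(\<Sum>x\<in>set_pmf p. (max 0 (f x))\<^sup>2 * pmf p x) = 0"
      using \<open>v = 0\<close> fin by (simp add: v_def integral_measure_pmf_real[of "set_pmf p"])
    then have "(max 0 (f x))\<^sup>2 * pmf p x = 0"
      using that fin by (subst (asm) sum_nonneg_eq_0_iff) auto
    then show ?thesis using that by (auto simp: set_pmf_iff max_def split: if_splits)
  qed
  have "(\<Sum>x\<in>set_pmf p. - f x * pmf p x) = 0"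
    using mean fin by (simp add: integral_measure_pmf_real[of "set_pmf p"] sum_negf)
  then have "- f x * pmf p x = 0"
    using nonpos x fin by (subst (asm) sum_nonneg_eq_0_iff) (auto simp: mult_nonpos_nonneg)
  then show ?thesis using x by (simp add: set_pmf_iff)
qed

text \<open>Subtracting a nonnegative mean \<mu> only shrinks the event of a positive sum, so the
  centred case makes \<open>f\<close> constant. With \<mu> positive the sum would be positive almost
  surely, against the limit.\<close>

lemma replicate_pmf_nonneg_mean_eq_0:
  fixes p :: "'a pmf" and f :: "'a \<Rightarrow> real"
  assumes fin: "finite (set_pmf p)" and mean: "measure_pmf.expectation p f \<ge> 0"
    and lim: "(\<lambda>n. measure_pmf.prob (replicate_pmf n p) {xs. (\<Sum>i<n. f (xs ! i)) > 0}) \<longlonglongrightarrow> 0"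
    and x: "x \<in> set_pmf p"
  shows "f x = 0"
proof -
  define \<mu> where "\<mu> = measure_pmf.expectation p f"
  note int = integrable_measure_pmf_finite[OF fin]
  have eq: "f x = \<mu>" if "x \<in> set_pmf p" for x
  proof -
    have "f x - \<mu> = 0"
    proof (rule replicate_pmf_mean_zero_eq_0[OF fin _ _ that])
      show "measure_pmf.expectation p (\<lambda>x. f x - \<mu>) = 0" by (simp add: int \<mu>_def)
      show "(\<lambda>n. measure_pmf.prob (replicate_pmf n p) {xs. (\<Sum>i<n. f (xs ! i) - \<mu>) > 0}) \<longlonglongrightarrow> 0"
      proof (rule tendsto_sandwich[OF _ _ tendsto_const lim])
        have "measure_pmf.prob (replicate_pmf n p) {xs. (\<Sum>i<n. f (xs ! i) - \<mu>) > 0}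
            \<le> measure_pmf.prob (replicate_pmf n p) {xs. (\<Sum>i<n. f (xs ! i)) > 0}" for n
        proof (intro measure_pmf.finite_measure_mono subsetI CollectI)
          fix xs assume "xs \<in> {xs. (\<Sum>i<n. f (xs ! i) - \<mu>) > 0}"
          moreover have "0 \<le> real n * \<mu>" using mean by (simp add: \<mu>_def)
          ultimately show "(\<Sum>i<n. f (xs ! i)) > 0" by (simp add: sum_subtractf)
        qed simp
        then show "\<forall>\<^sub>F n in sequentially. measure_pmf.prob (replicate_pmf n p) {xs. (\<Sum>i<n. f (xs ! i) - \<mu>) > 0}
            \<le> measure_pmf.prob (replicate_pmf n p) {xs. (\<Sum>i<n. f (xs ! i)) > 0}"
          by simp
      qed simp
    qed
    then show ?thesis by simp
  qed
  have "\<mu> = 0"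
  proof (rule ccontr)
    assume "\<mu> \<noteq> 0"
    then have "\<mu> > 0" using mean by (simp add: \<mu>_def)
    have "measure_pmf.prob (replicate_pmf n p) {xs. (\<Sum>i<n. f (xs ! i)) > 0} = 1" if "n \<ge> 1" for n
    proof -
      have "(\<Sum>i<n. f (xs ! i)) > 0" if "xs \<in> set_pmf (replicate_pmf n p)" for xs
      proof -
        have "(\<Sum>i<n. f (xs ! i)) = (\<Sum>i<n. \<mu>)"
          using that by (intro sum.cong) (auto intro!: eq replicate_pmf_nth_in)
        then show ?thesis using \<open>\<mu> > 0\<close> \<open>n \<ge> 1\<close> by simp
      qed
      then show ?thesis by (subst measure_pmf.prob_eq_1) (auto intro!: AE_pmfI)
    qed
    then have "\<forall>\<^sub>F n in sequentially. 1 \<le> measure_pmf.prob (replicate_pmf n p) {xs. (\<Sum>i<n. f (xs ! i)) > 0}"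
      by (intro eventually_sequentiallyI[of 1]) auto
    from tendsto_lowerbound[OF lim this] show False by simp
  qed
  with eq x show ?thesis by simp
qed

section \<open>Universal random coding against a kernel\<close>

lemma finite_messages: "finite (messages R n)"
  by (simp add: messages_def)

text \<open>Keeps \<open>pmf_of_set (messages R n)\<close> meaningful and provides a default decoder
  output.\<close>

lemma one_in_messages: "R \<ge> 0 \<Longrightarrow> 1 \<in> messages R n"
  using ge_one_powr_ge_zero[of 2 "real n * R"] by (auto simp: messages_def le_nat_iff)

lemma card_messages_le: "real (card (messages R n)) \<le> exp (real n * R * ln 2)"
proof -
  have "real (card (messages R n)) \<le> 2 powr (real n * R)"
    by (simp add: messages_def of_nat_nat)
  then show ?thesis by (simp add: powr_def mult.commute)
qed

text \<open>Code words follow the source law, so the sent word and its output are distributed as in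
  \<open>input_output\<close> and are \<open>good\<close> together with high probability, while
  every competing word is independent of the output. No channel enters the construction of the code,
  which makes it universal.\<close>

lemma universally_achievable_of_kernel:
  fixes p :: "'x::finite pmf" and k :: "'x \<Rightarrow> 'y \<Rightarrow> real" and l :: "'x \<Rightarrow> real"
  assumes k: "\<And>x y. k x y \<ge> 0" and l: "\<And>x. l x > 0"
    and sub: "\<And>y. measure_pmf.expectation p (\<lambda>x. l x * k x y) \<le> 1"
    and ker: "\<And>n xs ys. n \<ge> 1 \<Longrightarrow> xs \<in> set_pmf (replicate_pmf n p) \<Longrightarrow> length ys = n
        \<Longrightarrow> avg_distortion d n xs ys \<le> D \<Longrightarrow> 1 \<le> (\<Prod>i<n. k (xs ! i) (ys ! i))"
    and R: "R \<ge> 0" "R * ln 2 < measure_pmf.expectation p (\<lambda>x. ln (l x))"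
  shows "universally_achievable (channels_within p d D) R"
proof -
  \<comment> \<open>The midpoint. Its distance from \<open>R * ln 2\<close> beats the number of
    competitors, and its distance from the mean of \<open>ln (l x)\<close> makes the sent word
    typical.\<close>
  define L where "L = (R * ln 2 + measure_pmf.expectation p (\<lambda>x. ln (l x))) / 2"
  have L: "R * ln 2 < L" "L < measure_pmf.expectation p (\<lambda>x. ln (l x))"
    using R by (auto simp: L_def)
  define good where "good n xs ys \<longleftrightarrow>
    avg_distortion d n xs ys \<le> D \<and> real n * L \<le> (\<Sum>i<n. ln (l (xs ! i)))" for n xs and ys :: "'y list"
  \<comment> \<open>Any choice among several \<open>good\<close> messages will do, since the error
    bound already counts every \<open>good\<close> competitor as an error.\<close>
  define decode where "decode n enc ys =
    (if \<exists>m\<in>messages R n. good n (enc m) ys then SOME m. m \<in> messages R n \<and> good n (enc m) ys else 1)"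
    for n enc and ys :: "'y list"
  \<comment> \<open>The default \<open>undefined\<close> and the restriction make both maps
    extensional, as \<open>det_codes\<close> demands.\<close>
  define code where "code n = map_pmf (\<lambda>enc. (enc, restrict (decode n enc) (blocks n)))
    (Pi_pmf (messages R n) undefined (\<lambda>_. replicate_pmf n p))" for n
  note fin = finite_set_replicate_pmf[OF finite[of "set_pmf p"]]
  \<comment> \<open>Markov's inequality: the weighted product is at least
    \<open>exp (real n * L)\<close> on the event by typicality and \<open>ker\<close>, and its mean
    factorises into terms that are at most 1 by \<open>sub\<close>.\<close>
  have confusion: "measure_pmf.prob (replicate_pmf n p) {xs. good n xs ys} \<le> exp (- real n * L)"
    if "n \<ge> 1" "length ys = n" for n ys
  proof -
    have "measure_pmf.prob (replicate_pmf n p) {xs. good n xs ys} \<le>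
      measure_pmf.expectation (replicate_pmf n p)
        (\<lambda>xs. exp (- real n * L) * (\<Prod>i<n. l (xs ! i) * k (xs ! i) (ys ! i)))"
    proof (rule prob_le_expectation[OF fin])
      fix xs assume xs: "xs \<in> set_pmf (replicate_pmf n p)" "xs \<in> {xs. good n xs ys}"
      have "exp (real n * L) \<le> exp (\<Sum>i<n. ln (l (xs ! i)))"
        using xs by (simp add: good_def)
      also have "\<dots> = (\<Prod>i<n. l (xs ! i))" using l by (simp add: exp_sum)
      finally have "exp (real n * L) * 1 \<le> (\<Prod>i<n. l (xs ! i)) * (\<Prod>i<n. k (xs ! i) (ys ! i))"
        using xs that ker[of n xs ys] l by (intro mult_mono) (auto simp: good_def intro: prod_nonneg less_imp_le)
      then have "exp (- real n * L) * exp (real n * L) \<le>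
          exp (- real n * L) * (\<Prod>i<n. l (xs ! i) * k (xs ! i) (ys ! i))"
        by (intro mult_left_mono) (auto simp: prod.distrib)
      then show "1 \<le> exp (- real n * L) * (\<Prod>i<n. l (xs ! i) * k (xs ! i) (ys ! i))"
        by (simp flip: exp_add)
    qed (use k l in \<open>auto intro!: mult_nonneg_nonneg prod_nonneg intro: less_imp_le\<close>)
    also have "\<dots> = exp (- real n * L) *
        (\<Prod>i<n. measure_pmf.expectation p (\<lambda>x. l x * k x (ys ! i)))"
      using expectation_replicate_pmf_prod[OF finite, where g = "\<lambda>i x. l x * k x (ys ! i)" and n = n and p = p]
      by simp
    also have "\<dots> \<le> exp (- real n * L)"
      using sub k l by (intro mult_left_le prod_le_1)
        (auto intro!: integral_nonneg_AE AE_pmfI mult_nonneg_nonneg intro: less_imp_le)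
    finally show ?thesis .
  qed
  have "is_sc_code R code"
    unfolding is_sc_code_def
  proof (intro allI impI subsetI)
    fix n z assume "n \<ge> 1" "z \<in> set_pmf (code n)"
    then obtain enc where enc: "enc \<in> PiE_dflt (messages R n) undefined (\<lambda>_. set_pmf (replicate_pmf n p))"
      and z: "z = (enc, restrict (decode n enc) (blocks n))"
      by (auto simp: code_def set_Pi_pmf finite_messages)
    have "decode n enc ys \<in> messages R n" for ys
      using one_in_messages[OF R(1)] someI_ex[of "\<lambda>m. m \<in> messages R n \<and> good n (enc m) ys"]
      by (auto simp: decode_def)
    moreover have "enc \<in> messages R n \<rightarrow>\<^sub>E blocks n"
      using enc by (auto simp: PiE_dflt_def blocks_def length_replicate_pmf PiE_def extensional_def)
    ultimately show "z \<in> det_codes R n" by (auto simp: z det_codes_def)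
  qed
  moreover have "(\<lambda>n. measure_pmf.prob (message_decoded R code c n) {(m, m'). m' \<noteq> m}) \<longlonglongrightarrow> 0"
    if c: "c \<in> channels_within p d D" for c
  proof -
    have set_c: "length ys = n" if "n \<ge> 1" "length xs = n" "ys \<in> set_pmf (c n xs)" for n xs ys
      using c that by (auto simp: channels_within_def is_channel_def blocks_def)
    have bound: "measure_pmf.prob (message_decoded R code c n) {(m, m'). m' \<noteq> m} \<le>
      measure_pmf.prob (input_output p c n) {(xs, ys). \<not> good n xs ys} + exp (- real n * (L - R * ln 2))"
      if n: "n \<ge> 1" for n
      unfolding message_decoded_def
    proof (rule prob_bind_pmf_le)
      fix m assume "m \<in> set_pmf (pmf_of_set (messages R n))"
      then have m: "m \<in> messages R n"
        using one_in_messages[OF R(1)] by (subst (asm) set_pmf_of_set) (auto simp: finite_messages)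
      define A where "A = messages R n - {m}"
      define Q where "Q = Pi_pmf A undefined (\<lambda>_. replicate_pmf n p)"
      have ins: "messages R n = insert m A" "finite A" "m \<notin> A"
        using m by (auto simp: A_def finite_messages)
      \<comment> \<open>The word of the sent message is split off. The channel sees only this word,
        so its output can be drawn before the others, and for fixed output the rest of the codebook
        \<open>Q\<close> is still i.i.d.\<close>
      have code_eq: "code n = bind_pmf (replicate_pmf n p) (\<lambda>x. map_pmf (\<lambda>f. (f(m := x),
          restrict (decode n (f(m := x))) (blocks n))) Q)"
        unfolding code_def Q_def ins(1) using ins(2,3)
        by (subst Pi_pmf_insert) (auto simp: map_pmf_comp pair_pmf_def map_bind_pmf map_pmf_def bind_assoc_pmf bind_return_pmf o_def)
      have "bind_pmf (code n) (\<lambda>(enc, dec). map_pmf (\<lambda>ys. (m, dec ys)) (c n (enc m))) =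
        bind_pmf (replicate_pmf n p) (\<lambda>x. bind_pmf (c n x) (\<lambda>ys. map_pmf
          (\<lambda>f. (m, restrict (decode n (f(m := x))) (blocks n) ys)) Q))"
        unfolding code_eq bind_assoc_pmf bind_map_pmf
        by (intro bind_pmf_cong refl)
          (simp add: map_pmf_def bind_commute_pmf[of Q])
      moreover have "input_output p c n = bind_pmf (replicate_pmf n p) (\<lambda>x. bind_pmf (c n x) (\<lambda>ys. return_pmf (x, ys)))"
        by (simp add: input_output_def map_pmf_def)
      moreover have "measure_pmf.prob (map_pmf (\<lambda>f. (m, restrict (decode n (f(m := x))) (blocks n) ys)) Q)
            {(m, m'). m' \<noteq> m}
          \<le> measure_pmf.prob (return_pmf (x, ys)) {(xs, ys). \<not> good n xs ys} + exp (- real n * (L - R * ln 2))"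
        if "x \<in> set_pmf (replicate_pmf n p)" "ys \<in> set_pmf (c n x)" for x ys
      proof (cases "good n x ys")
        case False
        then show ?thesis by (auto intro!: order_trans[OF measure_pmf.prob_le_1])
      next
        case True
        have ys: "length ys = n" using set_c n that by (auto dest: length_replicate_pmf)
        \<comment> \<open>The sent message itself qualifies, so a wrong answer is a competitor that
          qualifies as well.\<close>
        have other: "\<exists>m'\<in>A. good n (f m') ys"
          if "restrict (decode n (f(m := x))) (blocks n) ys \<noteq> m" for f
        proof -
          let ?e = "f(m := x)" and ?m = "SOME m'. m' \<in> messages R n \<and> good n ((f(m := x)) m') ys"
          have ex: "\<exists>m'\<in>messages R n. good n (?e m') ys" using True m by auto
          then have "?m \<in> messages R n \<and> good n (?e ?m) ys"
            by (intro someI_ex[of "\<lambda>m'. m' \<in> messages R n \<and> good n (?e m') ys"]) auto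
          moreover have "decode n ?e ys = ?m" using ex by (simp add: decode_def)
          moreover have "decode n ?e ys \<noteq> m" using that ys by (simp add: blocks_def)
          ultimately show ?thesis unfolding A_def by (metis DiffI fun_upd_other singletonD)
        qed
        have "measure_pmf.prob (map_pmf (\<lambda>f. (m, restrict (decode n (f(m := x))) (blocks n) ys)) Q)
            {(m, m'). m' \<noteq> m} \<le> measure_pmf.prob Q (\<Union>m'\<in>A. {f. good n (f m') ys})"
          using other by (auto intro!: measure_pmf.finite_measure_mono)
        also have "\<dots> \<le> (\<Sum>m'\<in>A. measure_pmf.prob Q {f. good n (f m') ys})"
          using ins by (intro measure_pmf.finite_measure_subadditive_finite) auto
        also have "\<dots> \<le> (\<Sum>m'\<in>A. exp (- real n * L))"
        proof (rule sum_mono)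
          fix m' assume "m' \<in> A"
          then have "map_pmf (\<lambda>f. f m') Q = replicate_pmf n p"
            using ins by (simp add: Q_def Pi_pmf_component)
          then have "measure_pmf.prob Q {f. good n (f m') ys} = measure_pmf.prob (replicate_pmf n p) {xs. good n xs ys}"
            using measure_map_pmf[of "\<lambda>f. f m'" Q "{xs. good n xs ys}"] by (simp add: vimage_def)
          then show "measure_pmf.prob Q {f. good n (f m') ys} \<le> exp (- real n * L)"
            using confusion[OF n ys] by simp
        qed
        also have "\<dots> \<le> real (card (messages R n)) * exp (- real n * L)"
          by (simp add: A_def card_mono finite_messages)
        also have "\<dots> \<le> exp (real n * R * ln 2) * exp (- real n * L)"
          using card_messages_le by (intro mult_right_mono) auto
        also have "\<dots> = exp (- real n * (L - R * ln 2))"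
          by (simp add: algebra_simps flip: exp_add)
        finally show ?thesis by (simp add: add_increasing)
      qed
      ultimately show "measure_pmf.prob (bind_pmf (code n) (\<lambda>(enc, dec). map_pmf (\<lambda>ys. (m, dec ys)) (c n (enc m))))
          {(m, m'). m' \<noteq> m} \<le>
        measure_pmf.prob (input_output p c n) {(xs, ys). \<not> good n xs ys} + exp (- real n * (L - R * ln 2))"
        by (simp only:) (intro prob_bind_pmf_le_add)
    qed
    \<comment> \<open>The first marginal of \<open>input_output\<close> is the source law, so
      atypicality of the sent word is a pure source event whatever the channel is.\<close>
    have not_good: "measure_pmf.prob (input_output p c n) {(xs, ys). \<not> good n xs ys} \<le>
        measure_pmf.prob (input_output p c n) {(xs, ys). avg_distortion d n xs ys > D} +
        measure_pmf.prob (replicate_pmf n p) {xs. (\<Sum>i<n. - ln (l (xs ! i))) > real n * - L}" for n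
    proof -
      have "map_pmf fst (input_output p c n) = replicate_pmf n p"
        by (simp add: input_output_def map_bind_pmf map_pmf_comp bind_return_pmf')
      then have "measure_pmf.prob (replicate_pmf n p) {xs. (\<Sum>i<n. - ln (l (xs ! i))) > real n * - L}
        = measure_pmf.prob (input_output p c n) {(xs, ys). (\<Sum>i<n. - ln (l (xs ! i))) > real n * - L}"
        using measure_map_pmf[of fst "input_output p c n" "{xs. (\<Sum>i<n. - ln (l (xs ! i))) > real n * - L}"]
        by (simp add: vimage_def case_prod_unfold)
      moreover have "measure_pmf.prob (input_output p c n) {(xs, ys). \<not> good n xs ys} \<le>
        measure_pmf.prob (input_output p c n) ({(xs, ys). avg_distortion d n xs ys > D} \<union>
          {(xs, ys). (\<Sum>i<n. - ln (l (xs ! i))) > real n * - L})"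
        by (intro measure_pmf.finite_measure_mono) (auto simp: good_def sum_negf)
      ultimately show ?thesis
        by (simp only:) (erule order_trans, intro measure_Un_le, auto)
    qed
    have tail: "(\<lambda>n. measure_pmf.prob (replicate_pmf n p) {xs. (\<Sum>i<n. - ln (l (xs ! i))) > real n * - L}) \<longlonglongrightarrow> 0"
      using L by (intro replicate_pmf_upper_tail) auto
    have "(\<lambda>n. exp (- (L - R * ln 2)) ^ n) \<longlonglongrightarrow> 0"
      using L by (intro LIMSEQ_realpow_zero) auto
    then have "(\<lambda>n. exp (- real n * (L - R * ln 2))) \<longlonglongrightarrow> 0"
      by (simp add: algebra_simps flip: exp_of_nat_mult)
    then have lim: "(\<lambda>n. (measure_pmf.prob (input_output p c n) {(xs, ys). avg_distortion d n xs ys > D} +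
        measure_pmf.prob (replicate_pmf n p) {xs. (\<Sum>i<n. - ln (l (xs ! i))) > real n * - L}) +
        exp (- real n * (L - R * ln 2))) \<longlonglongrightarrow> 0 + 0 + 0"
      using c tail by (intro tendsto_add) (auto simp: channels_within_def)
    show ?thesis
    proof (rule tendsto_sandwich[OF _ _ tendsto_const])
      show "\<forall>\<^sub>F n in sequentially. measure_pmf.prob (message_decoded R code c n) {(m, m'). m' \<noteq> m} \<le>
        (measure_pmf.prob (input_output p c n) {(xs, ys). avg_distortion d n xs ys > D} +
        measure_pmf.prob (replicate_pmf n p) {xs. (\<Sum>i<n. - ln (l (xs ! i))) > real n * - L}) +
        exp (- real n * (L - R * ln 2))"
        using bound not_good by (intro eventually_sequentiallyI[of 1]) (meson add_right_mono order_trans)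
    qed (use lim in auto)
  qed
  ultimately show ?thesis using R by (auto simp: universally_achievable_def)
qed

section \<open>Random source codes from a test channel\<close>

text \<open>The memoryless extension of the one-letter channel \<open>W\<close>. Outputs at
  different positions have different laws given the input, hence the recursion in place of
  \<open>replicate_pmf\<close>.\<close>

primrec list_channel :: "('x \<Rightarrow> 'y pmf) \<Rightarrow> 'x list \<Rightarrow> 'y list pmf" where
  "list_channel W [] = return_pmf []"
| "list_channel W (x # xs) =
    bind_pmf (W x) (\<lambda>y. bind_pmf (list_channel W xs) (\<lambda>ys. return_pmf (y # ys)))"

lemma length_list_channel: "ys \<in> set_pmf (list_channel W xs) \<Longrightarrow> length ys = length xs"
  by (induction xs arbitrary: ys) auto

text \<open>Passes between i.i.d. pairs, for which tail bounds are available, and a source block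
  sent through the memoryless channel, which is what the covering argument conditions on.\<close>

lemma replicate_pmf_joint:
  "replicate_pmf n (bind_pmf p (\<lambda>x. map_pmf (Pair x) (W x))) =
    bind_pmf (replicate_pmf n p) (\<lambda>xs. map_pmf (zip xs) (list_channel W xs))"
proof (induction n)
  case (Suc n)
  have "replicate_pmf (Suc n) (bind_pmf p (\<lambda>x. map_pmf (Pair x) (W x))) =
    bind_pmf p (\<lambda>x. bind_pmf (W x) (\<lambda>y. bind_pmf (replicate_pmf n p) (\<lambda>xs.
      bind_pmf (list_channel W xs) (\<lambda>ys. return_pmf ((x, y) # zip xs ys)))))"
    unfolding replicate_pmf.simps Suc.IH by (simp add: map_pmf_def bind_assoc_pmf bind_return_pmf)
  also have "\<dots> = bind_pmf p (\<lambda>x. bind_pmf (replicate_pmf n p) (\<lambda>xs. bind_pmf (W x) (\<lambda>y.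
      bind_pmf (list_channel W xs) (\<lambda>ys. return_pmf ((x, y) # zip xs ys)))))"
    by (subst bind_commute_pmf[of "W _"]) (rule refl)
  also have "\<dots> = bind_pmf (replicate_pmf (Suc n) p) (\<lambda>xs. map_pmf (zip xs) (list_channel W xs))"
    by (simp add: map_pmf_def bind_assoc_pmf bind_return_pmf)
  finally show ?case .
qed (simp add: bind_return_pmf)

lemma pmf_bind_Cons:
  "pmf (bind_pmf P (\<lambda>x. bind_pmf Q (\<lambda>xs. return_pmf (x # xs)))) (y # ys) = pmf P y * pmf Q ys"
proof -
  have "bind_pmf P (\<lambda>x. bind_pmf Q (\<lambda>xs. return_pmf (x # xs))) =
      map_pmf (\<lambda>(x, xs). x # xs) (pair_pmf P Q)"
    by (simp add: pair_pmf_def map_pmf_def bind_assoc_pmf bind_return_pmf)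
  moreover have "pmf (map_pmf (\<lambda>(x, xs). x # xs) (pair_pmf P Q)) ((\<lambda>(x, xs). x # xs) (y, ys)) = pmf (pair_pmf P Q) (y, ys)"
    by (rule pmf_map_inj') (auto simp: inj_def)
  ultimately show ?thesis by (simp add: pmf_pair)
qed

text \<open>Letters with \<open>pmf (W x) y = 0\<close> do no harm: there \<open>ln 0 = 0\<close>, and the bound reads \<open>0 \<le> pmf q y\<close>.\<close>

lemma pmf_list_channel_le:
  assumes q: "\<And>y. pmf q y > 0" and "length xs = length ys"
  shows "pmf (list_channel W xs) ys \<le>
    exp (\<Sum>i<length xs. ln (pmf (W (xs ! i)) (ys ! i) / pmf q (ys ! i))) * pmf (replicate_pmf (length xs) q) ys"
  using assms(2)
proof (induction xs ys rule: list_induct2)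
  case (Cons x xs y ys)
  have "pmf (W x) y \<le> exp (ln (pmf (W x) y / pmf q y)) * pmf q y"
    using q[of y] by (cases "pmf (W x) y = 0") (auto simp: less_le)
  then have "pmf (W x) y * pmf (list_channel W xs) ys \<le> (exp (ln (pmf (W x) y / pmf q y)) * pmf q y) *
    (exp (\<Sum>i<length xs. ln (pmf (W (xs ! i)) (ys ! i) / pmf q (ys ! i))) * pmf (replicate_pmf (length xs) q) ys)"
    using Cons.IH by (intro mult_mono) auto
  then show ?case
    by (simp add: pmf_bind_Cons sum.lessThan_Suc_shift exp_add mult_ac del: sum.lessThan_Suc)
qed simp

lemma finite_length_eq: "finite {ys::'a::finite list. length ys = n}"
  using finite_lists_length_eq[of "UNIV :: 'a set" n] by simp

text \<open>Change of measure: on \<open>B\<close> the density of the channel output with respect to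
  i.i.d. \<open>q\<close> is at most \<open>exp c\<close>.\<close>

lemma prob_list_channel_le:
  fixes q :: "'y::finite pmf"
  assumes q: "\<And>y. pmf q y > 0"
    and B: "\<And>ys. ys \<in> B \<Longrightarrow> length ys = length xs"
      "\<And>ys. ys \<in> B \<Longrightarrow> (\<Sum>i<length xs. ln (pmf (W (xs ! i)) (ys ! i) / pmf q (ys ! i))) \<le> c"
  shows "measure_pmf.prob (list_channel W xs) B \<le> exp c * measure_pmf.prob (replicate_pmf (length xs) q) B"
proof -
  have "finite B"
    using B(1) by (intro finite_subset[OF _ finite_length_eq[of "length xs"]]) auto
  then have "measure_pmf.prob (list_channel W xs) B = (\<Sum>ys\<in>B. pmf (list_channel W xs) ys)"
    by (rule measure_measure_pmf_finite)
  also have "\<dots> \<le> (\<Sum>ys\<in>B. exp c * pmf (replicate_pmf (length xs) q) ys)"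
  proof (rule sum_mono)
    fix ys assume "ys \<in> B"
    then show "pmf (list_channel W xs) ys \<le> exp c * pmf (replicate_pmf (length xs) q) ys"
      using B by (intro order_trans[OF pmf_list_channel_le[OF q]] mult_right_mono) auto
  qed
  also have "\<dots> = exp c * measure_pmf.prob (replicate_pmf (length xs) q) B"
    using \<open>finite B\<close> by (simp add: measure_measure_pmf_finite sum_distrib_left)
  finally show ?thesis .
qed

section \<open>Covering by a random codebook\<close>

lemma prob_replicate_pmf_avoid:
  assumes "finite (set_pmf Q)"
  shows "measure_pmf.prob (replicate_pmf K Q) {C. \<forall>y\<in>set C. y \<notin> A} = (1 - measure_pmf.prob Q A) ^ K"
proof -
  have "measure_pmf.prob (replicate_pmf K Q) {C. \<forall>y\<in>set C. y \<notin> A}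
      = measure_pmf.expectation (replicate_pmf K Q) (indicator {C. \<forall>y\<in>set C. y \<notin> A})"
    by simp
  also have "\<dots> = measure_pmf.expectation (replicate_pmf K Q) (\<lambda>C. \<Prod>i<K. indicator (- A) (C ! i))"
  proof (intro integral_cong_AE AE_pmfI)
    fix C assume "C \<in> set_pmf (replicate_pmf K Q)"
    then have "length C = K" by (rule length_replicate_pmf)
    then show "indicator {C. \<forall>y\<in>set C. y \<notin> A} C = (\<Prod>i<K. indicator (- A) (C ! i) :: real)"
      by (auto simp: indicator_def all_set_conv_all_nth in_set_conv_nth)
  qed auto
  also have "\<dots> = measure_pmf.prob Q (- A) ^ K"
    by (simp add: expectation_replicate_pmf_prod[OF assms, where g = "\<lambda>_. indicator (- A)"])
  also have "measure_pmf.prob Q (- A) = 1 - measure_pmf.prob Q A"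
    using measure_pmf.prob_compl[of A Q] by (simp add: Compl_eq_Diff_UNIV)
  finally show ?thesis .
qed

text \<open>Exchanging the draw of the codebook with the draw of \<open>x\<close> turns the average
  uncovered mass into the chance that \<open>K\<close> independent words all miss
  \<open>B x\<close>; some codebook is no worse than average.\<close>

lemma exists_covering_list:
  fixes B :: "'a \<Rightarrow> 'b set"
  assumes "finite (set_pmf Q)"
  obtains C where "C \<in> set_pmf (replicate_pmf K Q)"
    "measure_pmf.prob P {x. \<forall>y\<in>set C. y \<notin> B x} \<le> measure_pmf.expectation P (\<lambda>x. (1 - measure_pmf.prob Q (B x)) ^ K)"
proof -
  obtain C where C: "C \<in> set_pmf (replicate_pmf K Q)"
    "measure_pmf.prob P {x. \<forall>y\<in>set C. y \<notin> B x} \<le>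
      measure_pmf.expectation (replicate_pmf K Q) (\<lambda>C. measure_pmf.prob P {x. \<forall>y\<in>set C. y \<notin> B x})"
    by (rule exists_le_expectation[OF finite_set_replicate_pmf[OF assms]])
  define F where "F C x \<longleftrightarrow> (\<forall>y\<in>set C. y \<notin> B x)" for C x
  \<comment> \<open>Both averages are read as the probability of \<open>True\<close> in a two-stage
    experiment, so that Fubini becomes \<open>bind_commute_pmf\<close>.\<close>
  have "measure_pmf.expectation (replicate_pmf K Q) (\<lambda>C. measure_pmf.prob P {x. F C x}) =
    measure_pmf.prob (bind_pmf (replicate_pmf K Q) (\<lambda>C. bind_pmf P (\<lambda>x. return_pmf (F C x)))) {True}"
    by (simp add: prob_bind_pmf vimage_def flip: map_pmf_def)
  also have "bind_pmf (replicate_pmf K Q) (\<lambda>C. bind_pmf P (\<lambda>x. return_pmf (F C x)))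
      = bind_pmf P (\<lambda>x. bind_pmf (replicate_pmf K Q) (\<lambda>C. return_pmf (F C x)))"
    by (rule bind_commute_pmf)
  also have "measure_pmf.prob \<dots> {True} = measure_pmf.expectation P (\<lambda>x. measure_pmf.prob (replicate_pmf K Q) {C. F C x})"
    by (simp add: prob_bind_pmf vimage_def flip: map_pmf_def)
  also have "\<dots> = measure_pmf.expectation P (\<lambda>x. (1 - measure_pmf.prob Q (B x)) ^ K)"
    unfolding F_def by (simp add: prob_replicate_pmf_avoid[OF assms])
  finally show ?thesis using C that by (simp add: F_def)
qed

text \<open>The chord of the exponential between 0 and \<open>- a\<close>. It splits the failure of
  the covering into an atypical test channel output, of probability \<open>1 - u\<close>, and a
  small remainder.\<close>

lemma exp_minus_mult_le:
  fixes a u :: real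
  assumes "0 \<le> u" "u \<le> 1"
  shows "exp (- a * u) \<le> (1 - u) + exp (- a)"
proof -
  have "exp ((1 - u) *\<^sub>R 0 + u *\<^sub>R (- a)) \<le> (1 - u) * exp 0 + u * exp (- a)"
    using assms by (intro convex_onD[OF exp_convex]) auto
  also have "\<dots> \<le> (1 - u) + exp (- a)"
    using assms by (simp add: mult_left_le_one_le)
  finally show ?thesis by (simp add: mult.commute)
qed

lemma one_minus_power_le_exp:
  fixes u :: real
  assumes "u \<le> 1"
  shows "(1 - u) ^ K \<le> exp (- real K * u)"
proof -
  have "(1 - u) ^ K \<le> exp (- u) ^ K"
    using assms exp_ge_add_one_self[of "- u"] by (intro power_mono) auto
  then show ?thesis by (simp flip: exp_of_nat_mult)
qed

text \<open>An independent word drawn from \<open>q\<close> falls into the typical set of a source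
  block with probability at least \<open>exp (- real n * c)\<close> times that of the test channel,
  so slightly more than \<open>exp (real n * c)\<close> words cover it. The distortion hypothesis is
  a limit and not a bound on the mean, so that it also admits channels whose distortion never
  exceeds \<open>D\<close> but has mean \<open>D\<close>.\<close>

lemma source_achievable_of_test_channel:
  fixes p :: "'x::finite pmf" and q :: "'y::finite pmf" and W :: "'x \<Rightarrow> 'y pmf"
  defines "J \<equiv> bind_pmf p (\<lambda>x. map_pmf (Pair x) (W x))"
  assumes q: "\<And>y. pmf q y > 0"
    and dist: "(\<lambda>n. measure_pmf.prob (replicate_pmf n J)
      {zs. (\<Sum>i<n. case zs ! i of (x, y) \<Rightarrow> d x y) > real n * D}) \<longlonglongrightarrow> 0"
    and r: "r \<ge> 0" "measure_pmf.expectation J (\<lambda>(x, y). ln (pmf (W x) y / pmf q y)) \<le> r * ln 2"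
  shows "source_achievable p d D r"
  unfolding source_achievable_def
proof (intro conjI allI impI r)
  fix \<delta> \<epsilon> :: real assume \<delta>: "\<delta> > 0" and \<epsilon>: "\<epsilon> > 0"
  \<comment> \<open>Strictly between \<open>r * ln 2\<close> and
    \<open>(r + \<delta>) * ln 2\<close>: the lower gap makes the information typical, the upper one
    leaves a surplus of code words.\<close>
  define c where "c = (r + \<delta> / 2) * ln 2"
  define info where "info = (\<lambda>(x, y). ln (pmf (W x) y / pmf q y))"
  define K where "K n = nat \<lfloor>2 powr (real n * (r + \<delta>))\<rfloor>" for n
  define bad where "bad n = measure_pmf.prob (replicate_pmf n J)
      {zs. (\<Sum>i<n. case zs ! i of (x, y) \<Rightarrow> d x y) > real n * D} +
    measure_pmf.prob (replicate_pmf n J) {zs. (\<Sum>i<n. info (zs ! i)) > real n * c}" for n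
  have "measure_pmf.expectation J info < c"
    using r \<delta> by (auto simp: c_def info_def intro!: order.strict_trans1[OF r(2)])
  then have "bad \<longlonglongrightarrow> 0 + 0"
    unfolding bad_def by (intro tendsto_add dist replicate_pmf_upper_tail) auto
  \<comment> \<open>The surplus of code words; the factor 1/2 pays for the floor in
    \<open>K n\<close>.\<close>
  define a where "a n = exp (real n * (\<delta> / 2 * ln 2)) / 2" for n
  have K: "real (K n) * exp (- real n * c) \<ge> a n" "K n \<ge> 1" "real (K n) \<le> 2 powr (real n * (r + \<delta>))" for n
  proof -
    let ?x = "2 powr (real n * (r + \<delta>))"
    have x: "?x \<ge> 1" using r \<delta> by (intro ge_one_powr_ge_zero) auto
    then show K1: "K n \<ge> 1" by (simp add: K_def le_nat_iff)
    have floor: "real (K n) = of_int \<lfloor>?x\<rfloor>" using x by (simp add: K_def)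
    then show "real (K n) \<le> ?x" by simp
    have "?x - 1 < real (K n)" unfolding floor by linarith
    then have "?x / 2 \<le> real (K n)" using K1 by linarith
    then have "?x / 2 * exp (- real n * c) \<le> real (K n) * exp (- real n * c)"
      by (intro mult_right_mono) auto
    moreover have "?x / 2 * exp (- real n * c) = a n"
      by (simp add: powr_def a_def c_def algebra_simps flip: exp_add)
    ultimately show "real (K n) * exp (- real n * c) \<ge> a n" by linarith
  qed
  have "filterlim (\<lambda>n. real n * (\<delta> / 2 * ln 2)) at_top sequentially"
    using \<delta> by (intro filterlim_at_top_mult_tendsto_pos[OF tendsto_const _ filterlim_real_sequentially]) auto
  from filterlim_compose[OF exp_at_top this]
  have "filterlim (\<lambda>n. exp (real n * (\<delta> / 2 * ln 2)) * (1 / 2)) at_top sequentially"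
    by (intro filterlim_at_top_mult_tendsto_pos[OF tendsto_const]) auto
  then have "filterlim a at_top sequentially" by (simp add: a_def[abs_def])
  then have "(\<lambda>n. exp (- a n)) \<longlonglongrightarrow> 0"
    by (intro filterlim_compose[OF exp_at_bot]) (auto simp: filterlim_uminus_at_bot)
  from tendsto_add[OF \<open>bad \<longlonglongrightarrow> 0 + 0\<close> this] have "(\<lambda>n. bad n + exp (- a n)) \<longlonglongrightarrow> 0" by simp
  from order_tendstoD(2)[OF this \<epsilon>]
  have "\<forall>\<^sub>F n in sequentially. bad n + exp (- a n) < \<epsilon> \<and> n \<ge> 1"
    using eventually_ge_at_top[of 1] by (rule eventually_conj)
  then show "\<forall>\<^sub>F n in sequentially. \<exists>s :: 'x list \<Rightarrow> 'y list.
        s \<in> blocks n \<rightarrow> blocks n \<and>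
        real (card (s ` blocks n)) \<le> 2 powr (real n * (r + \<delta>)) \<and>
        measure_pmf.prob (replicate_pmf n p) {xs. avg_distortion d n xs (s xs) > D} \<le> \<epsilon>"
  proof eventually_elim
    fix n assume n: "bad n + exp (- a n) < \<epsilon> \<and> n \<ge> 1"
    define B where "B xs = {ys. length ys = n \<and> (\<Sum>i<n. d (xs ! i) (ys ! i)) \<le> real n * D
      \<and> (\<Sum>i<n. info (xs ! i, ys ! i)) \<le> real n * c}" for xs
    define Q where "Q = replicate_pmf n q"
    have fin: "finite (set_pmf Q)" by (simp add: Q_def finite_set_replicate_pmf)
    obtain C where C: "C \<in> set_pmf (replicate_pmf (K n) Q)"
      "measure_pmf.prob (replicate_pmf n p) {x. \<forall>y\<in>set C. y \<notin> B x} \<le>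
        measure_pmf.expectation (replicate_pmf n p) (\<lambda>x. (1 - measure_pmf.prob Q (B x)) ^ K n)"
      by (rule exists_covering_list[OF fin])
    have length_C: "length C = K n" using C by (simp add: length_replicate_pmf)
    have C_blocks: "length y = n" if "y \<in> set C" for y
      using C that by (auto simp: set_replicate_pmf Q_def lists_eq_set)
    note int = integrable_measure_pmf_finite[OF finite_set_replicate_pmf[OF finite[of "set_pmf p"]]]
    have "measure_pmf.expectation (replicate_pmf n p) (\<lambda>xs. (1 - measure_pmf.prob Q (B xs)) ^ K n) \<le>
      measure_pmf.expectation (replicate_pmf n p)
        (\<lambda>xs. measure_pmf.prob (list_channel W xs) (- B xs) + exp (- a n))"
    proof (intro integral_mono_AE int AE_pmfI)
      fix xs assume "xs \<in> set_pmf (replicate_pmf n p)"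
      then have xs: "length xs = n" by (rule length_replicate_pmf)
      let ?u = "measure_pmf.prob (list_channel W xs) (B xs)"
      have "?u \<le> exp (real n * c) * measure_pmf.prob Q (B xs)"
        using prob_list_channel_le[OF q, of "B xs" xs W "real n * c"] xs by (auto simp: B_def Q_def info_def)
      then have u: "exp (- real n * c) * ?u \<le> measure_pmf.prob Q (B xs)"
        by (simp add: exp_minus field_simps)
      have "(1 - measure_pmf.prob Q (B xs)) ^ K n \<le> exp (- real (K n) * measure_pmf.prob Q (B xs))"
        by (rule one_minus_power_le_exp) simp
      also have "\<dots> \<le> exp (- real (K n) * (exp (- real n * c) * ?u))"
        using u by (simp add: mult_left_mono)
      also have "\<dots> = exp (- (real (K n) * exp (- real n * c)) * ?u)" by (simp add: mult_ac)
      also have "\<dots> \<le> exp (- a n * ?u)"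
        using mult_right_mono[OF K(1), of ?u n] by simp
      also have "\<dots> \<le> (1 - ?u) + exp (- a n)" by (rule exp_minus_mult_le) auto
      also have "1 - ?u = measure_pmf.prob (list_channel W xs) (- B xs)"
        using measure_pmf.prob_compl[of "B xs" "list_channel W xs"] by (simp add: Compl_eq_Diff_UNIV)
      finally show "(1 - measure_pmf.prob Q (B xs)) ^ K n \<le>
          measure_pmf.prob (list_channel W xs) (- B xs) + exp (- a n)" .
    qed
    also have "\<dots> = measure_pmf.expectation (replicate_pmf n p)
        (\<lambda>xs. measure_pmf.prob (list_channel W xs) (- B xs)) + exp (- a n)"
      by (simp add: int)
    also have "measure_pmf.expectation (replicate_pmf n p)
        (\<lambda>xs. measure_pmf.prob (list_channel W xs) (- B xs)) \<le>
      measure_pmf.expectation (replicate_pmf n p)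
        (\<lambda>xs. measure_pmf.prob (map_pmf (zip xs) (list_channel W xs))
          ({zs. (\<Sum>i<n. case zs ! i of (x, y) \<Rightarrow> d x y) > real n * D} \<union>
           {zs. (\<Sum>i<n. info (zs ! i)) > real n * c}))"
    proof (intro integral_mono_AE int AE_pmfI)
      fix xs assume "xs \<in> set_pmf (replicate_pmf n p)"
      then have xs: "length xs = n" by (rule length_replicate_pmf)
      show "measure_pmf.prob (list_channel W xs) (- B xs) \<le>
        measure_pmf.prob (map_pmf (zip xs) (list_channel W xs))
          ({zs. (\<Sum>i<n. case zs ! i of (x, y) \<Rightarrow> d x y) > real n * D} \<union>
           {zs. (\<Sum>i<n. info (zs ! i)) > real n * c})"
        unfolding measure_map_pmf
        by (intro measure_pmf.finite_measure_mono_AE AE_pmfI)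
          (auto simp: B_def xs not_le dest: length_list_channel)
    qed
    \<comment> \<open>Averaging over the source block restores the i.i.d. pairs, for which
      \<open>bad\<close> is known to vanish.\<close>
    also have "\<dots> = measure_pmf.prob (replicate_pmf n J)
          ({zs. (\<Sum>i<n. case zs ! i of (x, y) \<Rightarrow> d x y) > real n * D} \<union>
           {zs. (\<Sum>i<n. info (zs ! i)) > real n * c})"
      unfolding J_def replicate_pmf_joint by (rule prob_bind_pmf[symmetric])
    also have "\<dots> \<le> bad n" unfolding bad_def by (rule measure_Un_le) auto
    finally have cover: "measure_pmf.prob (replicate_pmf n p) {x. \<forall>y\<in>set C. y \<notin> B x} \<le> \<epsilon>"
      using C n by simp
    \<comment> \<open>Uncovered blocks go to \<open>C ! 0\<close>, which exists since
      \<open>K n \<ge> 1\<close> and keeps the image inside the codebook.\<close>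
    define s where "s xs = (if \<exists>y\<in>set C. y \<in> B xs then SOME y. y \<in> set C \<and> y \<in> B xs else C ! 0)" for xs
    have s_B: "s xs \<in> set C \<and> s xs \<in> B xs" if "\<exists>y\<in>set C. y \<in> B xs" for xs
      using that someI_ex[of "\<lambda>y. y \<in> set C \<and> y \<in> B xs"] by (auto simp: s_def)
    have s_C: "s xs \<in> set C" for xs
      using s_B[of xs] K(2)[of n] length_C by (cases "\<exists>y\<in>set C. y \<in> B xs") (auto simp: s_def)
    have "measure_pmf.prob (replicate_pmf n p) {xs. avg_distortion d n xs (s xs) > D}
      \<le> measure_pmf.prob (replicate_pmf n p) {x. \<forall>y\<in>set C. y \<notin> B x}"
    proof (intro measure_pmf.finite_measure_mono subsetI CollectI ballI notI)
      fix xs y assume *: "xs \<in> {xs. avg_distortion d n xs (s xs) > D}" "y \<in> set C" "y \<in> B xs"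
      then have "s xs \<in> B xs" using s_B by blast
      then have "avg_distortion d n xs (s xs) \<le> D"
        using n by (simp add: B_def avg_distortion_def field_simps)
      then show False using * by simp
    qed simp
    moreover have "card (s ` blocks n) \<le> K n"
      using s_C card_mono[of "set C" "s ` blocks n"] card_length[of C] length_C by (auto intro: order_trans)
    then have "real (card (s ` blocks n)) \<le> 2 powr (real n * (r + \<delta>))"
      using K(3)[of n] by linarith
    moreover have "s \<in> blocks n \<rightarrow> blocks n"
      using s_C C_blocks by (auto simp: blocks_def)
    ultimately show "\<exists>s :: 'x list \<Rightarrow> 'y list.
        s \<in> blocks n \<rightarrow> blocks n \<and>
        real (card (s ` blocks n)) \<le> 2 powr (real n * (r + \<delta>)) \<and>
        measure_pmf.prob (replicate_pmf n p) {xs. avg_distortion d n xs (s xs) > D} \<le> \<epsilon>"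
      using cover by (intro exI[of _ s]) auto
  qed
qed

section \<open>The converse\<close>

text \<open>Takes \<open>t n\<close> within \<open>1 / (n + 1)\<close> of the infimum. Source codes
  are given for each \<epsilon> separately, whereas a channel needs one sequence of them.\<close>

lemma select_vanishing:
  fixes f :: "nat \<Rightarrow> 's \<Rightarrow> real"
  assumes nonneg: "\<And>n s. f n s \<ge> 0"
    and ex: "\<And>\<epsilon>. \<epsilon> > 0 \<Longrightarrow> \<forall>\<^sub>F n in sequentially. \<exists>s. S n s \<and> f n s \<le> \<epsilon>"
  obtains t where "\<forall>\<^sub>F n in sequentially. S n (t n)" "(\<lambda>n. f n (t n)) \<longlonglongrightarrow> 0"
proof -
  define I where "I n = Inf (f n ` {s. S n s})" for n
  define t where "t n = (SOME s. S n s \<and> f n s \<le> I n + inverse (real (Suc n)))" for n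
  have bdd: "bdd_below (f n ` {s. S n s})" for n using nonneg by (intro bdd_belowI2[of _ 0]) auto
  have t: "S n (t n) \<and> f n (t n) \<le> I n + inverse (real (Suc n))" if "\<exists>s. S n s" for n
  proof -
    have ne: "f n ` {s. S n s} \<noteq> {}" using that by auto
    have "I n < I n + inverse (real (Suc n))" by simp
    then have "\<exists>z\<in>f n ` {s. S n s}. z < I n + inverse (real (Suc n))"
      unfolding I_def by (rule cInf_lessD[OF ne])
    then obtain s where "S n s" "f n s < I n + inverse (real (Suc n))" by blast
    then have "S n s \<and> f n s \<le> I n + inverse (real (Suc n))" by simp
    then show ?thesis unfolding t_def by (rule someI)
  qed
  have "\<forall>\<^sub>F n in sequentially. S n (t n)"
    by (rule eventually_mono[OF ex[of 1]]) (use t in auto)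
  moreover have "(\<lambda>n. f n (t n)) \<longlonglongrightarrow> 0"
  proof (rule tendstoI)
    fix e :: real assume e: "e > 0"
    have "\<forall>\<^sub>F n in sequentially. inverse (real (Suc n)) < e / 2"
      using order_tendstoD(2)[OF LIMSEQ_inverse_real_of_nat, of "e / 2"] e by simp
    moreover have "\<forall>\<^sub>F n in sequentially. \<exists>s. S n s \<and> f n s \<le> e / 2" using e by (intro ex) simp
    ultimately show "\<forall>\<^sub>F n in sequentially. dist (f n (t n)) 0 < e"
    proof eventually_elim
      fix n assume n: "inverse (real (Suc n)) < e / 2" "\<exists>s. S n s \<and> f n s \<le> e / 2"
      then obtain s where s: "S n s" "f n s \<le> e / 2" by auto
      then have "I n \<le> f n s" unfolding I_def by (intro cInf_lower bdd) auto
      then have "f n (t n) < e" using t[of n] s n(1) by fastforce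
      then show "dist (f n (t n)) 0 < e" using nonneg[of n "t n"] by simp
    qed
  qed
  ultimately show ?thesis using that by blast
qed

text \<open>For each realisation of the code, a correctly decoded message is the decoder's value at
  one of the possible channel outputs, so there are at most as many such messages as
  outputs.\<close>

lemma prob_correct_le_card:
  assumes R: "R \<ge> 0" and code: "set_pmf (k n) \<subseteq> det_codes R n"
    and s: "s \<in> blocks n \<rightarrow> blocks n" and fin: "finite (s ` blocks n)"
    and c: "\<And>xs. xs \<in> blocks n \<Longrightarrow> c n xs = return_pmf (s xs)"
  shows "measure_pmf.prob (message_decoded R k c n) {(m, m'). m' = m}
    \<le> real (card (s ` blocks n)) / real (card (messages R n))"
proof -
  have M: "messages R n \<noteq> {}" "finite (messages R n)"
    using one_in_messages[OF R] finite_messages by blast+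
  have "message_decoded R k c n = bind_pmf (k n) (\<lambda>(enc, dec). bind_pmf (pmf_of_set (messages R n))
      (\<lambda>m. map_pmf (\<lambda>ys. (m, dec ys)) (c n (enc m))))"
    unfolding message_decoded_def case_prod_beta by (rule bind_commute_pmf)
  also have "measure_pmf.prob \<dots> {(m, m'). m' = m} \<le> real (card (s ` blocks n)) / real (card (messages R n))"
  proof (rule prob_bind_pmf_le)
    fix z assume "z \<in> set_pmf (k n)"
    then obtain enc dec where z: "z = (enc, dec)" "enc \<in> messages R n \<rightarrow>\<^sub>E blocks n"
      using code by (auto simp: det_codes_def)
    then have enc: "enc m \<in> blocks n" if "m \<in> messages R n" for m
      using that by (auto intro: PiE_mem)
    have "bind_pmf (pmf_of_set (messages R n)) (\<lambda>m. map_pmf (\<lambda>ys. (m, dec ys)) (c n (enc m))) =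
      map_pmf (\<lambda>m. (m, dec (s (enc m)))) (pmf_of_set (messages R n))"
      unfolding map_pmf_def using M
      by (intro bind_pmf_cong refl) (simp add: c enc bind_return_pmf)
    moreover have "measure_pmf.prob \<dots> {(m, m'). m' = m} =
        real (card (messages R n \<inter> {m. dec (s (enc m)) = m})) / real (card (messages R n))"
      using M by (simp add: measure_pmf_of_set vimage_def)
    moreover have "card (messages R n \<inter> {m. dec (s (enc m)) = m}) \<le> card (dec ` s ` blocks n)"
    proof (intro card_mono finite_imageI[OF fin] subsetI)
      fix m assume "m \<in> messages R n \<inter> {m. dec (s (enc m)) = m}"
      then have "enc m \<in> blocks n" and eq: "dec (s (enc m)) = m" using enc by auto
      then have "dec (s (enc m)) \<in> dec ` s ` blocks n" by blast
      then show "m \<in> dec ` s ` blocks n" by (simp only: eq)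
    qed
    then have "card (messages R n \<inter> {m. dec (s (enc m)) = m}) \<le> card (s ` blocks n)"
      using card_image_le[OF fin, of dec] by linarith
    ultimately show "measure_pmf.prob (case z of (enc, dec) \<Rightarrow> bind_pmf (pmf_of_set (messages R n))
      (\<lambda>m. map_pmf (\<lambda>ys. (m, dec ys)) (c n (enc m)))) {(m, m'). m' = m} \<le>
      real (card (s ` blocks n)) / real (card (messages R n))"
      by (simp add: z divide_right_mono)
  qed
  finally show ?thesis .
qed

lemma card_messages_ge:
  assumes "R \<ge> 0"
  shows "2 powr (real n * R) / 2 \<le> real (card (messages R n))"
proof -
  have x: "2 powr (real n * R) \<ge> 1" using assms by (intro ge_one_powr_ge_zero) auto
  then have card: "real (card (messages R n)) = of_int \<lfloor>2 powr (real n * R)\<rfloor>"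
    by (simp add: messages_def)
  have "1 \<le> real (card (messages R n))" using x unfolding card by (simp add: le_floor_iff)
  then show ?thesis using card by linarith
qed

lemma universally_achievable_le_source_achievable:
  fixes p :: "'x::finite pmf" and d :: "'x \<Rightarrow> 'y::finite \<Rightarrow> real"
  assumes R: "universally_achievable (channels_within p d D) R" and r: "source_achievable p d D r"
  shows "R \<le> r"
proof (rule ccontr)
  assume "\<not> R \<le> r"
  \<comment> \<open>Half of the gap, so that the size of the source code still stays a factor
    \<open>2 powr (real n * \<delta>)\<close> below \<open>2 powr (real n * R)\<close>.\<close>
  define \<delta> where "\<delta> = (R - r) / 2"
  have \<delta>: "\<delta> > 0" "r + \<delta> = R - \<delta>" using \<open>\<not> R \<le> r\<close> by (auto simp: \<delta>_def field_simps)
  define S where "S n s \<longleftrightarrow> s \<in> blocks n \<rightarrow> blocks n \<and> real (card (s ` blocks n)) \<le> 2 powr (real n * (r + \<delta>))"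
    for n and s :: "'x list \<Rightarrow> 'y list"
  define f where "f n s = measure_pmf.prob (replicate_pmf n p) {xs. avg_distortion d n xs (s xs) > D}" for n s
  obtain t where t: "\<forall>\<^sub>F n in sequentially. S n (t n)" "(\<lambda>n. f n (t n)) \<longlonglongrightarrow> 0"
  proof (rule select_vanishing[of f S])
    show "\<forall>\<^sub>F n in sequentially. \<exists>s. S n s \<and> f n s \<le> \<epsilon>" if "\<epsilon> > 0" for \<epsilon>
      using r that \<delta> unfolding source_achievable_def S_def f_def by (simp add: conj_assoc)
  qed (auto simp: f_def)
  \<comment> \<open>Where \<open>t n\<close> does not map blocks to blocks, which happens for
    finitely many \<open>n\<close>, a constant block keeps \<open>is_channel\<close> true.\<close>
  define c :: "('x, 'y) channel" where
    "c n xs = return_pmf (if t n \<in> blocks n \<rightarrow> blocks n then t n xs else replicate n undefined)" for n xs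
  have "is_channel c" by (auto simp: is_channel_def c_def blocks_def)
  moreover have "(\<lambda>n. measure_pmf.prob (input_output p c n) {(xs, ys). avg_distortion d n xs ys > D}) \<longlonglongrightarrow> 0"
  proof (rule Lim_transform_eventually[OF t(2)])
    show "\<forall>\<^sub>F n in sequentially. f n (t n) = measure_pmf.prob (input_output p c n) {(xs, ys). avg_distortion d n xs ys > D}"
      using t(1)
    proof eventually_elim
      fix n assume "S n (t n)"
      then have "input_output p c n = map_pmf (\<lambda>xs. (xs, t n xs)) (replicate_pmf n p)"
        by (simp add: input_output_def c_def S_def map_pmf_def bind_return_pmf)
      then show "f n (t n) = measure_pmf.prob (input_output p c n) {(xs, ys). avg_distortion d n xs ys > D}"
        by (simp add: f_def vimage_def)
    qed
  qed
  ultimately have "c \<in> channels_within p d D" by (simp add: channels_within_def)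
  then obtain k where k: "is_sc_code R k"
    and err: "(\<lambda>n. measure_pmf.prob (message_decoded R k c n) {(m, m'). m' \<noteq> m}) \<longlonglongrightarrow> 0"
    using R unfolding universally_achievable_def by blast
  have "R \<ge> 0" using R by (simp add: universally_achievable_def)
  have "\<forall>\<^sub>F n in sequentially. 1 \<le> measure_pmf.prob (message_decoded R k c n) {(m, m'). m' \<noteq> m}
      + 2 * (2 powr - \<delta>) ^ n"
    using t(1) eventually_ge_at_top[of 1]
  proof eventually_elim
    fix n :: nat assume n: "S n (t n)" "1 \<le> n"
    have fin: "finite (t n ` blocks n)"
      by (intro finite_imageI) (simp add: blocks_def finite_length_eq)
    have "measure_pmf.prob (message_decoded R k c n) {(m, m'). m' = m}
      \<le> real (card (t n ` blocks n)) / real (card (messages R n))"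
      using n k fin \<open>R \<ge> 0\<close> by (intro prob_correct_le_card) (auto simp: is_sc_code_def S_def c_def)
    also have "\<dots> \<le> 2 powr (real n * (r + \<delta>)) / (2 powr (real n * R) / 2)"
      using n card_messages_ge[OF \<open>R \<ge> 0\<close>] by (intro frac_le) (auto simp: S_def)
    also have "\<dots> = 2 * 2 powr (- \<delta> * real n)"
      unfolding \<delta>(2) by (simp add: algebra_simps powr_diff powr_minus_divide)
    also have "\<dots> = 2 * (2 powr - \<delta>) ^ n" by (simp add: powr_powr flip: powr_realpow)
    finally have "measure_pmf.prob (message_decoded R k c n) {(m, m'). m' = m} \<le> 2 * (2 powr - \<delta>) ^ n" .
    moreover have "measure_pmf.prob (message_decoded R k c n) (- {(m, m'). m' = m})
        = 1 - measure_pmf.prob (message_decoded R k c n) {(m, m'). m' = m}"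
      using measure_pmf.prob_compl[of "{(m, m'). m' = m}" "message_decoded R k c n"]
      by (simp add: Compl_eq_Diff_UNIV)
    moreover have "- {(m, m'). m' = m} = {(m, m' :: nat). m' \<noteq> m}" by auto
    ultimately show "1 \<le> measure_pmf.prob (message_decoded R k c n) {(m, m'). m' \<noteq> m} + 2 * (2 powr - \<delta>) ^ n"
      by simp
  qed
  moreover have "(\<lambda>n. measure_pmf.prob (message_decoded R k c n) {(m, m'). m' \<noteq> m} + 2 * (2 powr - \<delta>) ^ n) \<longlonglongrightarrow> 0 + 2 * 0"
    using \<delta> by (intro tendsto_intros err LIMSEQ_realpow_zero) (auto simp: powr_less_one)
  ultimately show False using tendsto_lowerbound[of _ "0 + 2 * 0" sequentially 1] by fastforce
qed

section \<open>Convex duality for the rate-distortion problem\<close>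

text \<open>Real matrices in place of \<open>pmf\<close> values, because mixing and tilting are done
  entrywise.\<close>

definition stochastic :: "('x \<Rightarrow> 'y::finite \<Rightarrow> real) \<Rightarrow> bool" where
  "stochastic W \<longleftrightarrow> (\<forall>x y. 0 \<le> W x y) \<and> (\<forall>x. (\<Sum>y\<in>UNIV. W x y) = 1)"

text \<open>Strict positivity rules out division by zero in \<open>W x y / q y\<close>; boundary
  points are reached by a limit.\<close>

definition pos_dist :: "('y::finite \<Rightarrow> real) \<Rightarrow> bool" where
  "pos_dist q \<longleftrightarrow> (\<forall>y. 0 < q y) \<and> (\<Sum>y\<in>UNIV. q y) = 1"

text \<open>Relative entropy, in nats, of the joint law of input and output from the product of
  \<open>p\<close> and \<open>q\<close>. Its infimum over \<open>q\<close> is the mutual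
  information; keeping \<open>q\<close> free makes it jointly convex in
  \<open>(W, q)\<close>.\<close>

definition cond_divergence :: "'x::finite pmf \<Rightarrow> ('x \<Rightarrow> 'y::finite \<Rightarrow> real) \<Rightarrow> ('y \<Rightarrow> real) \<Rightarrow> real" where
  "cond_divergence p W q = (\<Sum>x\<in>UNIV. pmf p x * (\<Sum>y\<in>UNIV. W x y * ln (W x y / q y)))"

definition mean_distortion :: "'x::finite pmf \<Rightarrow> ('x \<Rightarrow> 'y::finite \<Rightarrow> real) \<Rightarrow> ('x \<Rightarrow> 'y \<Rightarrow> real) \<Rightarrow> real" where
  "mean_distortion p d W = (\<Sum>x\<in>UNIV. pmf p x * (\<Sum>y\<in>UNIV. W x y * d x y))"

text \<open>Equality holds at \<open>c = w / q\<close>, so \<open>w * ln (w / q)\<close> is a supremum of linear functions of \<open>(w, q)\<close>.\<close>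

lemma mult_ln_div_ge_tangent:
  fixes w q c :: real
  assumes "w \<ge> 0" "q > 0" "c > 0"
  shows "w * ln c + w - c * q \<le> w * ln (w / q)"
proof (cases "w = 0")
  case True
  then show ?thesis using assms by simp
next
  case False
  then have w: "w > 0" using assms by simp
  have "ln (c * q / w) \<le> c * q / w - 1" using assms w by (intro ln_le_minus_one) auto
  then have "w * ln (c * q / w) \<le> w * (c * q / w - 1)" using w by (intro mult_left_mono) auto
  then show ?thesis using assms w by (simp add: ln_div ln_mult algebra_simps)
qed

text \<open>Both terms on the right lie above the tangent with parameter \<open>c = w / q'\<close>,
  where the combined point has equality. The case \<open>w = 0\<close> is separate because the
  tangent needs \<open>c > 0\<close>.\<close>

lemma mult_ln_div_convex:
  fixes w1 w2 q1 q2 u v :: real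
  assumes w: "w1 \<ge> 0" "w2 \<ge> 0" and q: "q1 > 0" "q2 > 0" and uv: "u \<ge> 0" "v \<ge> 0" "u + v = 1"
  shows "(u * w1 + v * w2) * ln ((u * w1 + v * w2) / (u * q1 + v * q2))
    \<le> u * (w1 * ln (w1 / q1)) + v * (w2 * ln (w2 / q2))"
proof -
  define w where "w = u * w1 + v * w2"
  define q' where "q' = u * q1 + v * q2"
  have "q' > 0" using q uv unfolding q'_def
    by (cases "u = 0") (auto intro: add_pos_nonneg)
  have "w \<ge> 0" using w uv by (simp add: w_def)
  have "w * ln (w / q') \<le> u * (w1 * ln (w1 / q1)) + v * (w2 * ln (w2 / q2))"
  proof (cases "w = 0")
    case True
    then have "u * w1 = 0" "v * w2 = 0"
      using w uv unfolding w_def by (simp_all add: add_nonneg_eq_0_iff)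
    then show ?thesis using True by auto
  next
    case False
    define c where "c = w / q'"
    have c: "c > 0" "c * q' = w" using False \<open>w \<ge> 0\<close> \<open>q' > 0\<close> by (auto simp: c_def)
    have "w * ln c = (u * w1 + v * w2) * ln c + (u * w1 + v * w2) - c * (u * q1 + v * q2)"
      using c by (simp add: w_def q'_def)
    also have "\<dots> = u * (w1 * ln c + w1 - c * q1) + v * (w2 * ln c + w2 - c * q2)"
      by (simp add: algebra_simps)
    also have "\<dots> \<le> u * (w1 * ln (w1 / q1)) + v * (w2 * ln (w2 / q2))"
      using c w q uv by (intro add_mono mult_left_mono mult_ln_div_ge_tangent) auto
    finally show ?thesis by (simp add: c_def)
  qed
  then show ?thesis by (simp add: w_def q'_def)
qed

lemma cond_divergence_convex:
  assumes W: "stochastic W1" "stochastic W2" and q: "pos_dist q1" "pos_dist q2"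
    and uv: "u \<ge> 0" "v \<ge> 0" "u + v = (1::real)"
  shows "cond_divergence p (\<lambda>x y. u * W1 x y + v * W2 x y) (\<lambda>y. u * q1 y + v * q2 y)
    \<le> u * cond_divergence p W1 q1 + v * cond_divergence p W2 q2"
proof -
  have "cond_divergence p (\<lambda>x y. u * W1 x y + v * W2 x y) (\<lambda>y. u * q1 y + v * q2 y)
    \<le> (\<Sum>x\<in>UNIV. pmf p x * (\<Sum>y\<in>UNIV. u * (W1 x y * ln (W1 x y / q1 y)) + v * (W2 x y * ln (W2 x y / q2 y))))"
    unfolding cond_divergence_def using W q uv
    by (intro sum_mono mult_left_mono mult_ln_div_convex) (auto simp: stochastic_def pos_dist_def)
  also have "\<dots> = u * cond_divergence p W1 q1 + v * cond_divergence p W2 q2"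
    by (simp add: cond_divergence_def sum.distrib sum_distrib_left algebra_simps)
  finally show ?thesis .
qed

lemma mean_distortion_affine:
  "mean_distortion p d (\<lambda>x y. u * W1 x y + v * W2 x y) = u * mean_distortion p d W1 + v * mean_distortion p d W2"
  by (simp add: mean_distortion_def sum.distrib sum_distrib_left algebra_simps)

lemma stochastic_convex:
  assumes "stochastic W1" "stochastic W2" "u \<ge> 0" "v \<ge> 0" "u + v = (1::real)"
  shows "stochastic (\<lambda>x y. u * W1 x y + v * W2 x y)"
  using assms by (auto simp: stochastic_def sum.distrib simp flip: sum_distrib_left)

lemma pos_dist_convex:
  assumes "pos_dist q1" "pos_dist q2" "u \<ge> 0" "v \<ge> 0" "u + v = (1::real)"
  shows "pos_dist (\<lambda>y. u * q1 y + v * q2 y)"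
proof -
  have "0 < u * q1 y + v * q2 y" for y
    using assms by (cases "u = 0") (simp_all add: pos_dist_def add_pos_nonneg less_imp_le)
  then show ?thesis using assms by (auto simp: pos_dist_def sum.distrib simp flip: sum_distrib_left)
qed

lemma pos_dist_uniform: "pos_dist (\<lambda>y::'y::finite. 1 / real CARD('y))"
  by (simp add: pos_dist_def)

section \<open>Lagrange multiplier and optimal weights\<close>

text \<open>The upward closure of the attainable pairs of divergence and distortion is convex and
  misses the open quadrant below \<open>(R, D)\<close>; the normal of a separating line, scaled to
  first coordinate 1, gives \<open>s\<close>.\<close>

lemma lagrange_multiplier:
  fixes d :: "'x::finite \<Rightarrow> 'y::finite \<Rightarrow> real"
  assumes W0: "stochastic W0" "mean_distortion p d W0 < D"
    and R: "\<And>W q. stochastic W \<Longrightarrow> pos_dist q \<Longrightarrow> mean_distortion p d W < D \<Longrightarrow> R \<le> cond_divergence p W q"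
  obtains s where "s \<ge> 0" "\<And>W q. stochastic W \<Longrightarrow> pos_dist q
    \<Longrightarrow> R + s * D \<le> cond_divergence p W q + s * mean_distortion p d W"
proof -
  define S where "S = {(a, b). \<exists>W q. stochastic W \<and> pos_dist q \<and> cond_divergence p W q \<le> a \<and> mean_distortion p d W \<le> b}"
  define T where "T = {(a, b). a < R \<and> b < D}"
  have "convex S"
  proof (rule convexI)
    fix z1 z2 and u v :: real assume *: "z1 \<in> S" "z2 \<in> S" "0 \<le> u" "0 \<le> v" "u + v = 1"
    obtain W1 q1 where 1: "stochastic W1" "pos_dist q1" "cond_divergence p W1 q1 \<le> fst z1" "mean_distortion p d W1 \<le> snd z1"
      using *(1) by (auto simp: S_def)
    obtain W2 q2 where 2: "stochastic W2" "pos_dist q2" "cond_divergence p W2 q2 \<le> fst z2" "mean_distortion p d W2 \<le> snd z2"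
      using *(2) by (auto simp: S_def)
    have "cond_divergence p (\<lambda>x y. u * W1 x y + v * W2 x y) (\<lambda>y. u * q1 y + v * q2 y) \<le> u * fst z1 + v * fst z2"
      using 1 2 * by (intro order_trans[OF cond_divergence_convex] add_mono mult_left_mono) auto
    moreover have "mean_distortion p d (\<lambda>x y. u * W1 x y + v * W2 x y) \<le> u * snd z1 + v * snd z2"
      using 1 2 * by (simp add: mean_distortion_affine add_mono mult_left_mono)
    ultimately show "u *\<^sub>R z1 + v *\<^sub>R z2 \<in> S"
      using stochastic_convex[OF 1(1) 2(1) *(3-5)] pos_dist_convex[OF 1(2) 2(2) *(3-5)]
      by (auto simp: S_def case_prod_beta)
  qed
  moreover have "convex T"
  proof -
    have "T = {..<R} \<times> {..<D}" by (auto simp: T_def)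
    then show ?thesis by (simp add: convex_Times)
  qed
  moreover have "S \<noteq> {}" using W0 pos_dist_uniform by (auto simp: S_def)
  moreover have "(R - 1, D - 1) \<in> T" by (simp add: T_def)
  then have "T \<noteq> {}" by blast
  moreover have "T \<inter> S = {}" using R by (fastforce simp: S_def T_def)
  ultimately obtain z b where z: "z \<noteq> 0" "\<forall>x\<in>T. inner z x \<le> b" "\<forall>x\<in>S. b \<le> inner z x"
    using separating_hyperplane_sets[of T S] by auto
  obtain \<alpha> \<beta> where ab: "z = (\<alpha>, \<beta>)" by (cases z)
  have T: "\<alpha> * a + \<beta> * e \<le> b" if "a < R" "e < D" for a e
    using z(2) that by (auto simp: T_def ab)
  have S: "b \<le> \<alpha> * a + \<beta> * e" if "stochastic W" "pos_dist q" "cond_divergence p W q \<le> a" "mean_distortion p d W \<le> e" for W q a e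
    using z(3) that by (force simp: S_def ab)
  \<comment> \<open>\<open>S\<close> is closed upwards in both coordinates, so a negative
    coefficient would be unbounded below along a ray.\<close>
  have nonneg: "t = 0" if "t \<le> 0" "\<And>a. a \<ge> (0::real) \<Longrightarrow> C \<le> t * a" for t C :: real
  proof (rule ccontr)
    assume "t \<noteq> 0"
    then have "t < 0" using that by simp
    have "C \<le> t * ((\<bar>C\<bar> + 1) / - t)" using \<open>t < 0\<close> by (intro that divide_nonneg_pos) auto
    then show False using \<open>t < 0\<close> by simp
  qed
  have "\<alpha> \<ge> 0"
  proof (rule ccontr)
    assume "\<not> \<alpha> \<ge> 0"
    then show False
      using nonneg[of \<alpha> "b - \<alpha> * cond_divergence p W0 (\<lambda>y. 1 / real CARD('y)) - \<beta> * mean_distortion p d W0"]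
        S[OF W0(1) pos_dist_uniform, of "cond_divergence p W0 (\<lambda>y. 1 / real CARD('y)) + _" "mean_distortion p d W0"]
      by (auto simp: algebra_simps)
  qed
  have "\<beta> \<ge> 0"
  proof (rule ccontr)
    assume "\<not> \<beta> \<ge> 0"
    then show False
      using nonneg[of \<beta> "b - \<alpha> * cond_divergence p W0 (\<lambda>y. 1 / real CARD('y)) - \<beta> * mean_distortion p d W0"]
        S[OF W0(1) pos_dist_uniform, of "cond_divergence p W0 (\<lambda>y. 1 / real CARD('y))" "mean_distortion p d W0 + _"]
      by (auto simp: algebra_simps)
  qed
  \<comment> \<open>The corner lies only in the closure of \<open>T\<close> and is approached along
    the diagonal.\<close>
  have corner: "\<alpha> * R + \<beta> * D \<le> b"
  proof (rule field_le_epsilon)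
    fix e :: real assume "e > 0"
    define t where "t = e / (\<alpha> + \<beta> + 1)"
    have "t > 0" "(\<alpha> + \<beta>) * t \<le> e"
      using \<open>e > 0\<close> \<open>\<alpha> \<ge> 0\<close> \<open>\<beta> \<ge> 0\<close> by (auto simp: t_def field_simps add_pos_nonneg)
    then show "\<alpha> * R + \<beta> * D \<le> b + e"
      using T[of "R - t" "D - t"] by (simp add: algebra_simps)
  qed
  \<comment> \<open>Slater's condition: \<open>W0\<close> lies strictly below \<open>D\<close>,
    which excludes a vertical separating line.\<close>
  have "\<alpha> \<noteq> 0"
  proof
    assume "\<alpha> = 0"
    then have "\<beta> > 0" using z(1) ab \<open>\<beta> \<ge> 0\<close> by (auto simp: zero_prod_def)
    moreover have "\<beta> * D \<le> \<beta> * mean_distortion p d W0"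
      using corner S[OF W0(1) pos_dist_uniform order_refl order_refl] \<open>\<alpha> = 0\<close> by simp
    ultimately show False using W0 by simp
  qed
  then have "\<alpha> > 0" using \<open>\<alpha> \<ge> 0\<close> by simp
  show ?thesis
  proof (rule that[of "\<beta> / \<alpha>"])
    show "\<beta> / \<alpha> \<ge> 0" using \<open>\<alpha> > 0\<close> \<open>\<beta> \<ge> 0\<close> by simp
    fix W :: "'x \<Rightarrow> 'y \<Rightarrow> real" and q :: "'y \<Rightarrow> real" assume "stochastic W" "pos_dist q"
    then have "\<alpha> * R + \<beta> * D \<le> \<alpha> * cond_divergence p W q + \<beta> * mean_distortion p d W"
      using corner S[OF _ _ order_refl order_refl, of W q] by linarith
    then have "(\<alpha> * R + \<beta> * D) / \<alpha> \<le> (\<alpha> * cond_divergence p W q + \<beta> * mean_distortion p d W) / \<alpha>"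
      using \<open>\<alpha> > 0\<close> by (intro divide_right_mono) auto
    then show "R + \<beta> / \<alpha> * D \<le> cond_divergence p W q + \<beta> / \<alpha> * mean_distortion p d W"
      using \<open>\<alpha> > 0\<close> by (simp add: add_divide_distrib)
  qed
qed

text \<open>Evaluates the Lagrangian at its minimiser for fixed \<open>q\<close>, the Gibbs kernel
  proportional to \<open>q y * k x y\<close>, where it collapses to the logarithm of the normalising
  constant.\<close>

lemma tilted_bound:
  fixes d :: "'x::finite \<Rightarrow> 'y::finite \<Rightarrow> real"
  assumes lag: "\<And>W :: 'x \<Rightarrow> 'y \<Rightarrow> real. stochastic W \<Longrightarrow> R + s * D \<le> cond_divergence p W q + s * mean_distortion p d W"
    and q: "pos_dist q"
  shows "(\<Sum>x\<in>UNIV. pmf p x * ln (\<Sum>y\<in>UNIV. q y * exp (- s * (d x y - D)))) \<le> - R"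
proof -
  define k where "k x y = exp (- s * (d x y - D))" for x y
  define a where "a x = (\<Sum>y\<in>UNIV. q y * k x y)" for x
  define W where "W x y = q y * k x y / a x" for x y
  have qpos: "q y > 0" for y using q by (simp add: pos_dist_def)
  have a: "a x > 0" for x unfolding a_def by (intro sum_pos) (auto simp: k_def qpos)
  have sumW: "(\<Sum>y\<in>UNIV. W x y) = 1" for x
    using a[of x] by (simp add: W_def a_def flip: sum_divide_distrib)
  then have W: "stochastic W"
    using a qpos by (auto simp: stochastic_def W_def k_def intro!: divide_nonneg_pos mult_nonneg_nonneg less_imp_le)
  have lnW: "ln (W x y / q y) = - s * (d x y - D) - ln (a x)" for x y
  proof -
    have "W x y / q y = k x y / a x" using qpos[of y] by (simp add: W_def)
    then show ?thesis using a[of x] by (simp add: ln_div k_def)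
  qed
  have "cond_divergence p W q = (\<Sum>x\<in>UNIV. pmf p x * (\<Sum>y\<in>UNIV. (s * D - ln (a x)) * W x y - s * (W x y * d x y)))"
    unfolding cond_divergence_def lnW by (intro sum.cong refl arg_cong2[of _ _ _ _ "(*)"]) (simp add: algebra_simps)
  also have "\<dots> = (\<Sum>x\<in>UNIV. pmf p x * ((s * D - ln (a x)) - s * (\<Sum>y\<in>UNIV. W x y * d x y)))"
    by (simp add: sum_subtractf sumW flip: sum_distrib_left)
  also have "\<dots> = s * D * (\<Sum>x\<in>UNIV. pmf p x) - (\<Sum>x\<in>UNIV. pmf p x * ln (a x)) - s * mean_distortion p d W"
    by (simp add: mean_distortion_def right_diff_distrib sum_subtractf sum_distrib_left mult_ac)
  finally have "cond_divergence p W q + s * mean_distortion p d W = s * D - (\<Sum>x\<in>UNIV. pmf p x * ln (a x))"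
    by (simp add: sum_pmf_eq_1)
  with lag[OF W] show ?thesis by (simp add: a_def k_def)
qed

text \<open>The weights are \<open>l x = 1 / (\<Sum>y. v y * k x y)\<close> for an output distribution \<open>v\<close> that maximises the
  expected logarithm. It is maximised in the form of a product of powers because \<open>k\<close> may vanish and
  \<open>ln 0 = 0\<close> would destroy continuity.\<close>

lemma kuhn_tucker_weights:
  fixes k :: "'x::finite \<Rightarrow> 'y::finite \<Rightarrow> real"
  assumes k: "\<And>x y. k x y \<ge> 0" and ex: "\<And>x. x \<in> set_pmf p \<Longrightarrow> \<exists>y. k x y > 0"
    and R: "\<And>q. pos_dist q \<Longrightarrow> (\<Sum>x\<in>UNIV. pmf p x * ln (\<Sum>y\<in>UNIV. q y * k x y)) \<le> - R"
  obtains l where "\<And>x. l x > 0" "\<And>y. (\<Sum>x\<in>UNIV. pmf p x * (l x * k x y)) \<le> 1"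
    "R \<le> (\<Sum>x\<in>UNIV. pmf p x * ln (l x))"
proof -
  define S where "S = {v :: real ^ 'y. (\<forall>y. 0 \<le> v $ y) \<and> (\<Sum>y\<in>UNIV. v $ y) = 1}"
  define a where "a v x = (\<Sum>y\<in>UNIV. v $ y * k x y)" for v :: "real ^ 'y" and x
  define G where "G v = (\<Prod>x\<in>set_pmf p. a v x powr pmf p x)" for v
  define u :: "real ^ 'y" where "u = (\<chi> y. 1 / real CARD('y))"
  have u: "u \<in> S" by (simp add: S_def u_def)
  have a_nonneg: "a v x \<ge> 0" if "v \<in> S" for v x
    using that k by (auto simp: a_def S_def intro!: sum_nonneg)
  have a_pos: "a v x > 0" if v: "\<And>y. v $ y > 0" and x: "x \<in> set_pmf p" for v x
  proof -
    obtain y where "k x y > 0" using ex[OF x] by blast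
    then show ?thesis unfolding a_def using v k
      by (intro sum_pos2[of _ y]) (auto intro!: mult_nonneg_nonneg intro: less_imp_le)
  qed
  have "compact S"
  proof -
    have "closed S"
      unfolding S_def by (intro closed_Collect_conj closed_Collect_all closed_Collect_le closed_Collect_eq continuous_intros)
    moreover have "bounded S"
    proof (rule boundedI)
      fix v assume "v \<in> S"
      then show "norm v \<le> 1" using norm_le_l1_cart[of v] by (simp add: S_def)
    qed
    ultimately show ?thesis by (simp add: compact_eq_bounded_closed)
  qed
  moreover have "continuous_on S G"
    unfolding G_def
  proof (intro continuous_on_prod continuous_on_powr' continuous_on_const)
    show "continuous_on S (\<lambda>v. a v x)" for x
      unfolding a_def by (intro continuous_intros)
  qed (use a_nonneg in \<open>auto intro: pmf_positive\<close>)
  ultimately obtain v where v: "v \<in> S" "\<And>w. w \<in> S \<Longrightarrow> G w \<le> G v"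
    using continuous_attains_sup[of S G] u by blast
  \<comment> \<open>The uniform point has a positive value, hence so does the maximum, and no
    \<open>a v x\<close> with \<open>x\<close> in the support vanishes. Logarithms are safe from
    here on.\<close>
  have "G u > 0"
    unfolding G_def
  proof (intro prod_pos)
    fix x assume "x \<in> set_pmf p"
    then have "a u x > 0" by (intro a_pos) (simp_all add: u_def)
    then show "0 < a u x powr pmf p x" by simp
  qed
  then have "G v > 0" using v(2)[OF u] by linarith
  then have av: "a v x > 0" if "x \<in> set_pmf p" for x
    using that a_nonneg[OF v(1), of x] unfolding G_def by (auto simp: less_le prod_zero_iff)
  have G_ln: "G w = exp (\<Sum>x\<in>set_pmf p. pmf p x * ln (a w x))" if "\<And>x. x \<in> set_pmf p \<Longrightarrow> a w x > 0" for w
  proof -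
    have "a w x powr pmf p x = exp (pmf p x * ln (a w x))" if "x \<in> set_pmf p" for x
      using \<open>\<And>x. x \<in> set_pmf p \<Longrightarrow> a w x > 0\<close>[OF that] by (auto simp: powr_def)
    then show ?thesis by (simp add: G_def exp_sum)
  qed
  have sum_set: "(\<Sum>x\<in>set_pmf p. pmf p x * h x) = (\<Sum>x\<in>UNIV. pmf p x * h x)" for h :: "'x \<Rightarrow> real"
    by (intro sum.mono_neutral_left) (auto simp: set_pmf_iff)
  define l where "l x = (if x \<in> set_pmf p then 1 / a v x else 1)" for x
  show ?thesis
  proof (rule that[of l])
    show "l x > 0" for x using av by (simp add: l_def)
    show "(\<Sum>x\<in>UNIV. pmf p x * (l x * k x y)) \<le> 1" for y
    proof (rule ccontr)
      assume "\<not> (\<Sum>x\<in>UNIV. pmf p x * (l x * k x y)) \<le> 1"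
      then have gt: "(\<Sum>x\<in>set_pmf p. pmf p x * (k x y / a v x)) > 1"
        by (simp add: sum_set[symmetric] l_def)
      \<comment> \<open>Moves from the maximiser towards the vertex at \<open>y\<close>. The
        derivative at 0 is the sum in question minus 1, and it cannot be positive at a
        maximum.\<close>
      define h where "h t = (\<Sum>x\<in>set_pmf p. pmf p x * ln ((1 - t) * a v x + t * k x y))" for t :: real
      have "(h has_real_derivative (\<Sum>x\<in>set_pmf p. pmf p x * ((k x y - a v x) / a v x))) (at 0)"
        unfolding h_def using av
        by (auto intro!: derivative_eq_intros sum.cong)
      moreover have "(\<Sum>x\<in>set_pmf p. pmf p x * ((k x y - a v x) / a v x))
          = (\<Sum>x\<in>set_pmf p. pmf p x * (k x y / a v x) - pmf p x)"
      proof (intro sum.cong refl)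
        fix x assume "x \<in> set_pmf p"
        then have "a v x \<noteq> 0" using av by force
        then show "pmf p x * ((k x y - a v x) / a v x) = pmf p x * (k x y / a v x) - pmf p x"
          by (simp add: diff_divide_distrib right_diff_distrib)
      qed
      then have "(\<Sum>x\<in>set_pmf p. pmf p x * ((k x y - a v x) / a v x)) > 0"
        using gt by (simp add: sum_subtractf sum_pmf_eq_1)
      ultimately obtain e where e: "e > 0" "\<forall>t>0. t < e \<longrightarrow> h 0 < h (0 + t)"
        using DERIV_pos_inc_right by blast
      define t where "t = min (e / 2) (1 / 2)"
      have t: "0 < t" "t < e" "t < 1" using e by (auto simp: t_def)
      define w where "w = (1 - t) *\<^sub>R v + t *\<^sub>R axis y 1"
      have "w \<in> S"
        using v(1) t by (auto simp: S_def w_def axis_def sum.distrib simp flip: sum_distrib_left)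
      have aw: "a w x = (1 - t) * a v x + t * k x y" for x
      proof -
        have "a w x = (\<Sum>z\<in>UNIV. (1 - t) * (v $ z * k x z) + (if z = y then t * k x z else 0))"
          unfolding a_def by (intro sum.cong) (auto simp: w_def axis_def algebra_simps)
        then show ?thesis by (simp add: sum.distrib a_def sum_distrib_left)
      qed
      have "h t \<le> h 0"
      proof -
        have "a w x > 0" if "x \<in> set_pmf p" for x
          using av[OF that] t k[of x y] by (auto simp: aw intro!: add_pos_nonneg)
        then have "exp (h t) \<le> exp (h 0)"
          using v(2)[OF \<open>w \<in> S\<close>] av by (simp add: G_ln) (simp add: h_def aw)
        then show ?thesis by simp
      qed
      then show False using e t by auto
    qed
    \<comment> \<open>The maximiser may have zero entries while \<open>R\<close> is assumed for
      positive \<open>q\<close> only. Mixing in the uniform point with weight \<open>t\<close> costs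
      at most \<open>- ln (1 - t)\<close>, which tends to 0.\<close>
    have "((\<lambda>t. ln (1 - t) + (\<Sum>x\<in>set_pmf p. pmf p x * ln (a v x))) \<longlongrightarrow> ln (1 - 0) + (\<Sum>x\<in>set_pmf p. pmf p x * ln (a v x))) (at_right 0)"
      by (intro tendsto_intros) auto
    moreover have "\<forall>\<^sub>F t in at_right 0. ln (1 - t) + (\<Sum>x\<in>set_pmf p. pmf p x * ln (a v x)) \<le> - R"
    proof -
      have "ln (1 - t) + (\<Sum>x\<in>set_pmf p. pmf p x * ln (a v x)) \<le> - R" if t: "0 < t" "t < 1" for t
      proof -
        define w where "w = (1 - t) *\<^sub>R v + t *\<^sub>R u"
        have "pos_dist (\<lambda>y. w $ y)"
          using v(1) u t by (auto simp: S_def w_def pos_dist_def sum.distrib u_def add_nonneg_pos simp flip: sum_distrib_left)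
        have "ln (1 - t) + (\<Sum>x\<in>set_pmf p. pmf p x * ln (a v x)) = (\<Sum>x\<in>set_pmf p. pmf p x * (ln (1 - t) + ln (a v x)))"
          by (simp add: distrib_left sum.distrib sum_pmf_eq_1 flip: sum_distrib_right)
        also have "\<dots> \<le> (\<Sum>x\<in>set_pmf p. pmf p x * ln (a w x))"
        proof (intro sum_mono mult_left_mono)
          fix x assume x: "x \<in> set_pmf p"
          have "a w x = (1 - t) * a v x + t * a u x"
            by (simp add: a_def w_def algebra_simps sum.distrib sum_subtractf sum_distrib_left)
          then have "(1 - t) * a v x \<le> a w x" using a_nonneg[OF u, of x] t by simp
          then have "ln ((1 - t) * a v x) \<le> ln (a w x)"
            using av[OF x] t by (intro ln_mono) auto
          then show "ln (1 - t) + ln (a v x) \<le> ln (a w x)"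
            using av[OF x] t by (simp add: ln_mult)
        qed auto
        also have "\<dots> \<le> - R" using R[OF \<open>pos_dist (\<lambda>y. w $ y)\<close>] by (simp add: sum_set a_def)
        finally show ?thesis .
      qed
      then show ?thesis by (auto simp: eventually_at_right_field intro!: exI[of _ 1])
    qed
    ultimately have "ln (1 - 0) + (\<Sum>x\<in>set_pmf p. pmf p x * ln (a v x)) \<le> - R"
      by (intro tendsto_upperbound[where F = "at_right (0::real)"]) auto
    moreover have "(\<Sum>x\<in>set_pmf p. pmf p x * ln (l x)) = - (\<Sum>x\<in>set_pmf p. pmf p x * ln (a v x))"
      unfolding sum_negf[symmetric] using av by (intro sum.cong) (auto simp: l_def ln_div)
    ultimately show "R \<le> (\<Sum>x\<in>UNIV. pmf p x * ln (l x))" by (simp add: sum_set[symmetric])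
  qed
qed

section \<open>The universal capacity\<close>

lemma obtain_pmf:
  fixes w :: "'a::finite \<Rightarrow> real"
  assumes "\<And>x. 0 \<le> w x" "(\<Sum>x\<in>UNIV. w x) = 1"
  obtains P where "\<And>x. pmf P x = w x"
proof (rule that[of "embed_pmf w"])
  show "pmf (embed_pmf w) x = w x" for x
    using assms by (intro pmf_embed_pmf) (auto simp: nn_integral_count_space_finite)
qed

lemma expectation_joint:
  fixes p :: "'x::finite pmf" and W :: "'x \<Rightarrow> 'y::finite pmf" and g :: "'x \<times> 'y \<Rightarrow> real"
  shows "measure_pmf.expectation (bind_pmf p (\<lambda>x. map_pmf (Pair x) (W x))) g =
    (\<Sum>x\<in>UNIV. pmf p x * (\<Sum>y\<in>UNIV. pmf (W x) y * g (x, y)))"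
  by (subst expectation_bind_pmf_finite)
    (auto simp: integral_measure_pmf_real[of UNIV] mult.commute)

text \<open>The contrapositive of random source coding; \<open>dist\<close> lists two reasons for
  the average distortion to exceed \<open>D\<close> with vanishing probability.\<close>

lemma rate_le_cond_divergence:
  fixes p :: "'x::finite pmf" and d :: "'x \<Rightarrow> 'y::finite \<Rightarrow> real"
  assumes r: "r \<ge> 0" "\<not> source_achievable p d D r"
    and W: "stochastic W" and q: "pos_dist q"
    and dist: "mean_distortion p d W < D \<or> (\<forall>x\<in>set_pmf p. \<forall>y. W x y > 0 \<longrightarrow> d x y \<le> D)"
  shows "r * ln 2 \<le> cond_divergence p W q"
proof (rule ccontr)
  assume less: "\<not> r * ln 2 \<le> cond_divergence p W q"
  obtain Q where Q: "\<And>y. pmf Q y = q y"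
    using q by (rule_tac obtain_pmf[of q]) (auto simp: pos_dist_def less_imp_le)
  have "\<exists>V. \<forall>y. pmf V y = W x y" for x
    using W obtain_pmf[of "W x"] unfolding stochastic_def by metis
  then obtain V where V: "\<And>x y. pmf (V x) y = W x y" by metis
  define J where "J = bind_pmf p (\<lambda>x. map_pmf (Pair x) (V x))"
  have "(\<lambda>n. measure_pmf.prob (replicate_pmf n J)
      {zs. (\<Sum>i<n. case zs ! i of (x, y) \<Rightarrow> d x y) > real n * D}) \<longlonglongrightarrow> 0"
    using dist
  proof
    assume "mean_distortion p d W < D"
    then show ?thesis
      by (intro replicate_pmf_upper_tail) (auto simp: J_def expectation_joint V mean_distortion_def)
  next
    assume le: "\<forall>x\<in>set_pmf p. \<forall>y. W x y > 0 \<longrightarrow> d x y \<le> D"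
    have "measure_pmf.prob (replicate_pmf n J) {zs. (\<Sum>i<n. case zs ! i of (x, y) \<Rightarrow> d x y) > real n * D} = 0" for n
    proof -
      have "(\<Sum>i<n. case zs ! i of (x, y) \<Rightarrow> d x y) \<le> real n * D" if zs: "zs \<in> set_pmf (replicate_pmf n J)" for zs
      proof -
        have "(case zs ! i of (x, y) \<Rightarrow> d x y) \<le> D" if "i < n" for i
        proof -
          have "zs ! i \<in> set_pmf J" using replicate_pmf_nth_in[OF zs that] .
          then show ?thesis using le by (auto simp: J_def V dest: pmf_positive)
        qed
        then show ?thesis using sum_bounded_above[of "{..<n}" "\<lambda>i. case zs ! i of (x, y) \<Rightarrow> d x y" D] by simp
      qed
      then show ?thesis by (subst measure_pmf_zero_iff) force
    qed
    then show ?thesis by simp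
  qed
  moreover have "measure_pmf.expectation J (\<lambda>(x, y). ln (pmf (V x) y / pmf Q y)) \<le> r * ln 2"
    using less by (simp add: J_def expectation_joint V Q cond_divergence_def)
  ultimately have "source_achievable p d D r"
    using q r(1) unfolding J_def
    by (intro source_achievable_of_test_channel[where q = Q and W = V]) (auto simp: Q pos_dist_def)
  with r show False by simp
qed

text \<open>At the boundary \<open>D = E (m X)\<close> the sum of \<open>m\<close> would exceed its mean with probability bounded away
  from 0 unless \<open>m\<close> were constant.\<close>

lemma cheapest_output_eq:
  fixes p :: "'x::finite pmf" and d :: "'x \<Rightarrow> 'y \<Rightarrow> real"
  assumes c: "c \<in> channels_within p d D" and m: "\<And>x y. m x \<le> d x y"
    and mean: "D \<le> measure_pmf.expectation p m" and x: "x \<in> set_pmf p"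
  shows "m x = D"
proof -
  have "m x - D = 0"
  proof (rule replicate_pmf_nonneg_mean_eq_0[OF _ _ _ x])
    show "0 \<le> measure_pmf.expectation p (\<lambda>x. m x - D)"
      using mean by (simp add: integrable_measure_pmf_finite)
    show "(\<lambda>n. measure_pmf.prob (replicate_pmf n p) {xs. 0 < (\<Sum>i<n. m (xs ! i) - D)}) \<longlonglongrightarrow> 0"
    proof (rule tendsto_sandwich[OF _ _ tendsto_const])
      show "(\<lambda>n. measure_pmf.prob (input_output p c n) {(xs, ys). avg_distortion d n xs ys > D}) \<longlonglongrightarrow> 0"
        using c by (simp add: channels_within_def)
      have "measure_pmf.prob (replicate_pmf n p) {xs. 0 < (\<Sum>i<n. m (xs ! i) - D)}
          \<le> measure_pmf.prob (input_output p c n) {(xs, ys). avg_distortion d n xs ys > D}" if "n \<ge> 1" for n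
      proof -
        have "map_pmf fst (input_output p c n) = replicate_pmf n p"
          by (simp add: input_output_def map_bind_pmf map_pmf_comp bind_return_pmf')
        then have "measure_pmf.prob (replicate_pmf n p) {xs. 0 < (\<Sum>i<n. m (xs ! i) - D)} =
          measure_pmf.prob (input_output p c n) {(xs, ys). 0 < (\<Sum>i<n. m (xs ! i) - D)}"
          using measure_map_pmf[of fst "input_output p c n" "{xs. 0 < (\<Sum>i<n. m (xs ! i) - D)}"]
          by (simp add: vimage_def case_prod_unfold)
        also have "\<dots> \<le> measure_pmf.prob (input_output p c n) {(xs, ys). avg_distortion d n xs ys > D}"
        proof (intro measure_pmf.finite_measure_mono subsetI)
          fix z :: "'x list \<times> 'y list" assume z: "z \<in> {(xs, ys). 0 < (\<Sum>i<n. m (xs ! i) - D)}"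
          obtain xs ys where xy: "z = (xs, ys)" by (cases z)
          have "real n * D < (\<Sum>i<n. m (xs ! i))" using z by (simp add: xy sum_subtractf)
          also have "\<dots> \<le> (\<Sum>i<n. d (xs ! i) (ys ! i))" by (intro sum_mono m)
          finally show "z \<in> {(xs, ys). avg_distortion d n xs ys > D}"
            using that by (simp add: xy avg_distortion_def field_simps)
        qed simp
        finally show ?thesis .
      qed
      then show "\<forall>\<^sub>F n in sequentially. measure_pmf.prob (replicate_pmf n p) {xs. 0 < (\<Sum>i<n. m (xs ! i) - D)}
          \<le> measure_pmf.prob (input_output p c n) {(xs, ys). avg_distortion d n xs ys > D}"
        by (rule eventually_sequentiallyI)
    qed simp
  qed simp
  then show ?thesis by simp
qed

text \<open>The given member \<open>c\<close> enters in the case without a multiplier, where its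
  existence forces the least distortion to equal \<open>D\<close> on the support.\<close>

lemma universally_achievable_below_source_rate:
  fixes p :: "'x::finite pmf" and d :: "'x \<Rightarrow> 'y::finite \<Rightarrow> real"
  assumes c: "c \<in> channels_within p d D"
    and r: "\<not> source_achievable p d D r" and R: "0 \<le> R" "R < r"
  shows "universally_achievable (channels_within p d D) R"
proof -
  have "r \<ge> 0" using R by simp
  note rate = rate_le_cond_divergence[OF \<open>r \<ge> 0\<close> r]
  \<comment> \<open>Both cases provide the same interface: the first three properties feed
    \<open>kuhn_tucker_weights\<close>, the last is the Markov condition \<open>ker\<close>.\<close>
  have "\<exists>k. (\<forall>x y. 0 \<le> k x y) \<and> (\<forall>x\<in>set_pmf p. \<exists>y. 0 < k x y) \<and>
    (\<forall>q. pos_dist q \<longrightarrow> (\<Sum>x\<in>UNIV. pmf p x * ln (\<Sum>y\<in>UNIV. q y * k x y)) \<le> - (r * ln 2)) \<and>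
    (\<forall>n xs ys. n \<ge> 1 \<longrightarrow> xs \<in> set_pmf (replicate_pmf n p) \<longrightarrow> avg_distortion d n xs ys \<le> D
      \<longrightarrow> 1 \<le> (\<Prod>i<n. k (xs ! i) (ys ! i)))"
  proof (cases "\<exists>W. stochastic W \<and> mean_distortion p d W < D")
    case True
    then obtain W0 where W0: "stochastic W0" "mean_distortion p d W0 < D" by blast
    obtain s where s: "s \<ge> 0" "\<And>W q. stochastic W \<Longrightarrow> pos_dist q
        \<Longrightarrow> r * ln 2 + s * D \<le> cond_divergence p W q + s * mean_distortion p d W"
      using lagrange_multiplier[OF W0, of "r * ln 2"] rate by blast
    show ?thesis
    proof (intro exI[of _ "\<lambda>x y. exp (- s * (d x y - D))"] conjI allI impI ballI)
      fix q :: "'y \<Rightarrow> real" assume q: "pos_dist q"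
      show "(\<Sum>x\<in>UNIV. pmf p x * ln (\<Sum>y\<in>UNIV. q y * exp (- s * (d x y - D)))) \<le> - (r * ln 2)"
        using s q by (intro tilted_bound)
    next
      fix n xs ys assume n: "n \<ge> 1" "avg_distortion d n xs ys \<le> D"
      have "(\<Sum>i<n. d (xs ! i) (ys ! i)) \<le> real n * D"
        using n by (simp add: avg_distortion_def field_simps)
      then have "0 \<le> - s * ((\<Sum>i<n. d (xs ! i) (ys ! i)) - real n * D)"
        using s(1) by (intro mult_nonpos_nonpos) auto
      also have "\<dots> = (\<Sum>i<n. - s * (d (xs ! i) (ys ! i) - D))"
        by (simp only: sum_subtractf flip: sum_distrib_left) simp
      finally show "1 \<le> (\<Prod>i<n. exp (- s * (d (xs ! i) (ys ! i) - D)))"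
        by (simp flip: exp_sum)
    qed auto
  next
    case False
    \<comment> \<open>A cheapest output letter; always choosing it minimises the mean distortion,
      which is at least \<open>D\<close> in this case.\<close>
    define ym where "ym x = (ARG_MIN (d x) y. y \<in> UNIV)" for x
    have ym: "d x (ym x) \<le> d x y" for x y
      unfolding ym_def using arg_min_least[of UNIV y "d x"] by (simp add: arg_min_on_def)
    have "stochastic (\<lambda>x y. if y = ym x then 1 else 0)"
      by (simp add: stochastic_def)
    with False have "D \<le> mean_distortion p d (\<lambda>x y. if y = ym x then 1 else 0)" by force
    also have "\<dots> = measure_pmf.expectation p (\<lambda>x. d x (ym x))"
    proof -
      have "(\<Sum>y\<in>UNIV. (if y = ym x then 1 else 0) * d x y) = (\<Sum>y\<in>UNIV. if y = ym x then d x y else 0)" for x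
        by (intro sum.cong) auto
      then show ?thesis
        by (simp add: mean_distortion_def integral_measure_pmf_real[of UNIV] mult.commute)
    qed
    finally have min_eq: "d x (ym x) = D" if "x \<in> set_pmf p" for x
      using cheapest_output_eq[OF c ym _ that] by blast
    define k where "k x y = (if d x y \<le> D then 1 else (0::real))" for x y
    show ?thesis
    proof (intro exI[of _ k] conjI allI impI ballI)
      show "\<exists>y. 0 < k x y" if "x \<in> set_pmf p" for x
        using min_eq[OF that] by (intro exI[of _ "ym x"]) (simp add: k_def)
    next
      fix q :: "'y \<Rightarrow> real" assume q: "pos_dist q"
      have qpos: "q y > 0" for y using q by (simp add: pos_dist_def)
      define a where "a x = (\<Sum>y\<in>UNIV. q y * k x y)" for x
      have a: "a x > 0" if "x \<in> set_pmf p" for x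
        unfolding a_def using min_eq[OF that] qpos
        by (intro sum_pos2[of _ "ym x"]) (auto simp: k_def less_imp_le)
      \<comment> \<open>\<open>q\<close> conditioned on the letters allowed by \<open>k\<close>,
        with divergence \<open>- ln (a x)\<close> from \<open>q\<close>. Off the support,
        \<open>q\<close> itself keeps \<open>W\<close> stochastic.\<close>
      define W where "W x y = (if x \<in> set_pmf p then q y * k x y / a x else q y)" for x y
      have "0 \<le> W x y" for x y
        using a[of x] qpos[of y] by (auto simp: W_def k_def less_imp_le)
      moreover have sumW: "(\<Sum>y\<in>UNIV. W x y) = 1" for x
      proof (cases "x \<in> set_pmf p")
        case True
        then have "(\<Sum>y\<in>UNIV. W x y) = a x / a x"
          by (simp add: W_def a_def flip: sum_divide_distrib)
        then show ?thesis using a[OF True] by simp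
      qed (use q in \<open>simp add: W_def pos_dist_def\<close>)
      ultimately have "stochastic W" by (simp add: stochastic_def)
      then have "r * ln 2 \<le> cond_divergence p W q"
        by (intro rate q) (auto simp: W_def k_def split: if_splits)
      also have "\<dots> = (\<Sum>x\<in>UNIV. pmf p x * - ln (a x))"
        unfolding cond_divergence_def
      proof (intro sum.cong refl)
        fix x
        show "pmf p x * (\<Sum>y\<in>UNIV. W x y * ln (W x y / q y)) = pmf p x * - ln (a x)"
        proof (cases "x \<in> set_pmf p")
          case True
          have "W x y * ln (W x y / q y) = W x y * - ln (a x)" for y
            using True a[OF True] qpos[of y] by (auto simp: W_def k_def ln_div)
          then have "(\<Sum>y\<in>UNIV. W x y * ln (W x y / q y)) = - ln (a x)"
            by (simp only: sumW flip: sum_distrib_right)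
          then show ?thesis by simp
        next
          case False
          then show ?thesis by (simp add: set_pmf_iff)
        qed
      qed
      finally show "(\<Sum>x\<in>UNIV. pmf p x * ln (\<Sum>y\<in>UNIV. q y * k x y)) \<le> - (r * ln 2)"
        by (simp add: a_def sum_negf)
    next
      fix n xs ys assume n: "n \<ge> 1" "xs \<in> set_pmf (replicate_pmf n p)" "avg_distortion d n xs ys \<le> D"
      \<comment> \<open>Every term is at least \<open>D\<close> and the average at most
        \<open>D\<close>, so all are equal to \<open>D\<close> and every factor of the product is
        1.\<close>
      have ge: "D \<le> d (xs ! i) (ys ! i)" if "i < n" for i
        using ym[of "xs ! i" "ys ! i"] min_eq[OF replicate_pmf_nth_in[OF n(2) that]] by simp
      have "(\<Sum>i<n. d (xs ! i) (ys ! i)) \<le> real n * D"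
        using n by (simp add: avg_distortion_def field_simps)
      then have "(\<Sum>i<n. d (xs ! i) (ys ! i) - D) \<le> 0" by (simp add: sum_subtractf)
      moreover have "(\<Sum>i<n. d (xs ! i) (ys ! i) - D) \<ge> 0" using ge by (intro sum_nonneg) auto
      ultimately have "(\<Sum>i<n. d (xs ! i) (ys ! i) - D) = 0" by simp
      then have "d (xs ! i) (ys ! i) = D" if "i < n" for i
        using ge that by (subst (asm) sum_nonneg_eq_0_iff) auto
      then show "1 \<le> (\<Prod>i<n. k (xs ! i) (ys ! i))" by (simp add: k_def)
    qed (auto simp: k_def)
  qed
  then obtain k where k: "\<And>x y. 0 \<le> k x y" "\<And>x. x \<in> set_pmf p \<Longrightarrow> \<exists>y. 0 < k x y"
    "\<And>q. pos_dist q \<Longrightarrow> (\<Sum>x\<in>UNIV. pmf p x * ln (\<Sum>y\<in>UNIV. q y * k x y)) \<le> - (r * ln 2)"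
    "\<And>n xs ys. n \<ge> 1 \<Longrightarrow> xs \<in> set_pmf (replicate_pmf n p) \<Longrightarrow> avg_distortion d n xs ys \<le> D
      \<Longrightarrow> 1 \<le> (\<Prod>i<n. k (xs ! i) (ys ! i))" by blast
  obtain l where l: "\<And>x. l x > 0" "\<And>y. (\<Sum>x\<in>UNIV. pmf p x * (l x * k x y)) \<le> 1"
    "r * ln 2 \<le> (\<Sum>x\<in>UNIV. pmf p x * ln (l x))"
    using kuhn_tucker_weights[OF k(1-3)] by blast
  have "R * ln 2 < (\<Sum>x\<in>UNIV. pmf p x * ln (l x))"
    using R by (intro order.strict_trans2[OF _ l(3)]) simp
  with l k show ?thesis
    by (intro universally_achievable_of_kernel[where k = k and l = l] R)
      (auto simp: integral_measure_pmf_real[of UNIV] mult.commute)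
qed

section \<open>Empty families, rate zero and the final equality\<close>

text \<open>With no channel to serve, any code will do. This settles the case that
  \<open>channels_within p d D\<close> is empty, where the capacity is infinite.\<close>

lemma universally_achievable_empty:
  assumes "R \<ge> 0"
  shows "universally_achievable ({} :: ('x, 'y) channel set) R"
proof -
  define e :: "nat \<Rightarrow> (nat \<Rightarrow> 'x list) \<times> ('y list \<Rightarrow> nat)"
    where "e n = (restrict (\<lambda>_. replicate n undefined) (messages R n), restrict (\<lambda>_. 1) (blocks n))" for n
  have "is_sc_code R (\<lambda>n. return_pmf (e n))"
    using one_in_messages[OF assms] by (auto simp: is_sc_code_def det_codes_def e_def blocks_def)
  then show ?thesis using assms by (auto simp: universally_achievable_def)
qed

text \<open>A single message cannot be confused. This keeps the capacity nonnegative, as the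
  supremum of an empty set of extended reals would be minus infinity.\<close>

lemma universally_achievable_0:
  assumes "A \<subseteq> {c. is_channel c}"
  shows "universally_achievable (A :: ('x, 'y) channel set) 0"
proof -
  obtain k :: "('x, 'y) sc_code" where k: "is_sc_code 0 k"
    using universally_achievable_empty[of 0] by (auto simp: universally_achievable_def)
  have M: "messages 0 n = {1}" for n by (simp add: messages_def)
  have "measure_pmf.prob (message_decoded 0 k c n) {(m, m'). m' \<noteq> m} = 0" if "c \<in> A" "n \<ge> 1" for c n
  proof -
    have code: "enc 1 \<in> blocks n \<and> dec \<in> blocks n \<rightarrow> {1}" if "(enc, dec) \<in> set_pmf (k n)" for enc dec
      using k that \<open>n \<ge> 1\<close> by (fastforce simp: is_sc_code_def det_codes_def M)
    have "set_pmf (c n xs) \<subseteq> blocks n" if "xs \<in> blocks n" for xs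
      using assms \<open>c \<in> A\<close> \<open>n \<ge> 1\<close> that by (auto simp: is_channel_def)
    with code have "set_pmf (message_decoded 0 k c n) \<subseteq> {(1, 1)}"
      by (fastforce simp: message_decoded_def M pmf_of_set_singleton bind_return_pmf)
    then show ?thesis by (subst measure_pmf_zero_iff) auto
  qed
  then have "(\<lambda>n. measure_pmf.prob (message_decoded 0 k c n) {(m, m'). m' \<noteq> m}) \<longlonglongrightarrow> 0" if "c \<in> A" for c
    using that by (intro tendsto_eventually eventually_sequentiallyI[of 1]) auto
  with k show ?thesis by (auto simp: universally_achievable_def)
qed

theorem theorem3p1:
  fixes p :: "'x::finite pmf"
    and d :: "'x \<Rightarrow> 'y::finite \<Rightarrow> real"
    and D :: real
  assumes "\<And>x y. d x y \<ge> 0"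
  shows "universal_capacity (channels_within p d D) = rate_distortion p d D"
proof (rule antisym)
  show "universal_capacity (channels_within p d D) \<le> rate_distortion p d D"
    unfolding universal_capacity_def rate_distortion_def
    by (auto intro!: Sup_least Inf_greatest universally_achievable_le_source_achievable)
  show "rate_distortion p d D \<le> universal_capacity (channels_within p d D)"
  \<comment> \<open>Working from below treats finite and infinite values of
    \<open>rate_distortion\<close> alike.\<close>
  proof (rule dense_le)
    fix z assume z: "z < rate_distortion p d D"
    show "z \<le> universal_capacity (channels_within p d D)"
    proof (cases "z < 0")
      case True
      have "universally_achievable (channels_within p d D) 0"
        by (rule universally_achievable_0) (auto simp: channels_within_def)
      then have "ereal 0 \<le> universal_capacity (channels_within p d D)"
        unfolding universal_capacity_def by (intro Sup_upper) auto
      then show ?thesis using True by (simp add: zero_ereal_def)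
    next
      case False
      then obtain R where R: "z = ereal R" "R \<ge> 0"
        using z by (cases z) (auto simp: zero_ereal_def)
      \<comment> \<open>A second rate is inserted because the coding lemma needs an unachievable
        rate strictly above \<open>R\<close>.\<close>
      obtain r where r: "z < ereal r" "ereal r < rate_distortion p d D"
        using ereal_dense2[OF z] by blast
      have "\<not> source_achievable p d D r"
      proof
        assume "source_achievable p d D r"
        then have "rate_distortion p d D \<le> ereal r"
          unfolding rate_distortion_def by (intro Inf_lower) auto
        with r(2) show False by simp
      qed
      then have "universally_achievable (channels_within p d D) R"
        using universally_achievable_empty[OF R(2)] universally_achievable_below_source_rate R r(1)
        by (cases "channels_within p d D = {}") (auto, blast)
      then show ?thesis unfolding universal_capacity_def R(1) by (intro Sup_upper) auto
    qed
  qed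
qed

end
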